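(* Let $u=u_r(r,z,t)e_r+u_z(r,z,t)e_z$ be a smooth axisymmetric velocity field on $\mathbb{R}^3$ without swirl satisfying $\nabla\cdot u=0$, with vorticity $\nabla\times u=w^\theta e_\theta$. Then the estimate $$\|u\|_{L^{\frac{2p}{2-p}}(B_R\times[-R,R])}\le C_R\,\Big\|\frac{w^\theta}{r}\Big\|_{L^1\cap L^p(\mathbb{R}^3)}$$ holds for any $1<p<2$. Here $B_R=B_R(0)\subset\mathbb{R}^2$ is a two-dimensional ball and the constant $C_R$ depends only on $R$.
   Context: Cylindrical coordinates on $\mathbb{R}^3$ are $(r,\theta,z)$ with $e_r=(\cos\theta,\sin\theta,0)$, $e_\theta=(-\sin\theta,\cos\theta,0)$, $e_z=(0,0,1)$. A vector field is axisymmetric if it has the form $u_r(r,z,t)e_r+u_\theta(r,z,t)e_\theta+u_z(r,z,t)e_z$, and it is without swirl if $u_\theta=0$. For such a field without swirl the vorticity is $\nabla\times u=w^\theta e_\theta$ with $w^\theta=w_\theta=\partial_zu_r-\partial_ru_z$. $B_R=B_R(0)$ is the ball of radius $R$ centred at the origin of $\mathbb{R}^2$. The norms are in the space variable (time $t$ is a parameter), and $\|f\|_{L^1\cap L^p(\mathbb{R}^3)}=\|f\|_{L^1(\mathbb{R}^3)}+\|f\|_{L^p(\mathbb{R}^3)}$.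
   Formalization: Adds the assumption that the mean of |u| over the ball of radius ρ tends to 0 as ρ→∞ (without it u=e_z, with zero vorticity, is a counterexample), and the constant may depend on p as well as on R (no constant uniform in 1<p<2 exists, as p→2 shows). *)

theory Defs
  imports "HOL-Analysis.Analysis"
begin

definition e_r :: "real \<Rightarrow> real^3" where
  "e_r \<theta> = vector [cos \<theta>, sin \<theta>, 0]"

definition e_\<theta> :: "real \<Rightarrow> real^3" where
  "e_\<theta> \<theta> = vector [- sin \<theta>, cos \<theta>, 0]"

definition e_z :: "real^3" where
  "e_z = vector [0, 0, 1]"

definition cyl_point :: "real \<Rightarrow> real \<Rightarrow> real \<Rightarrow> real^3" where
  "cyl_point r \<theta> z = vector [r * cos \<theta>, r * sin \<theta>, z]"

definition cyl_radius :: "real^3 \<Rightarrow> real" where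
  "cyl_radius x = sqrt ((x$1)\<^sup>2 + (x$2)\<^sup>2)"

text \<open>
  On the axis \<open>r = 0\<close> the equation below is required for every \<open>\<theta>\<close>, so it forces
  \<open>u\<^sub>r = u\<^sub>\<theta> = 0\<close> there, as holds for every continuous axisymmetric field.  The values of the
  component functions at \<open>r < 0\<close> are irrelevant.
\<close>

definition axisymmetric_components ::
  "(real \<Rightarrow> real \<Rightarrow> real) \<Rightarrow> (real \<Rightarrow> real \<Rightarrow> real) \<Rightarrow> (real \<Rightarrow> real \<Rightarrow> real) \<Rightarrow> (real^3 \<Rightarrow> real^3) \<Rightarrow> bool"
  where
  "axisymmetric_components ur u\<theta> uz u \<longleftrightarrow>
     (\<forall>r\<ge>0. \<forall>\<theta> z. u (cyl_point r \<theta> z) = ur r z *\<^sub>R e_r \<theta> + u\<theta> r z *\<^sub>R e_\<theta> \<theta> + uz r z *\<^sub>R e_z)"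

primrec C_k :: "nat \<Rightarrow> (real^3 \<Rightarrow> real^3) \<Rightarrow> bool" where
  "C_k 0 u \<longleftrightarrow> continuous_on UNIV u"
| "C_k (Suc k) u \<longleftrightarrow>
     u differentiable_on UNIV \<and> (\<forall>v. C_k k (\<lambda>x. frechet_derivative u (at x) v))"

definition smooth :: "(real^3 \<Rightarrow> real^3) \<Rightarrow> bool" where
  "smooth u \<longleftrightarrow> (\<forall>k. C_k k u)"

text \<open>The entry \<open>jacobian u (at x) $ i $ j\<close> is the partial derivative of \<open>u\<^sub>i\<close> in the direction \<open>j\<close>.\<close>

definition divergence :: "(real^3 \<Rightarrow> real^3) \<Rightarrow> real^3 \<Rightarrow> real" where
  "divergence u x = trace (jacobian u (at x))"

definition curl :: "(real^3 \<Rightarrow> real^3) \<Rightarrow> real^3 \<Rightarrow> real^3" where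
  "curl u x = (let J = jacobian u (at x) in
     vector [J$3$2 - J$2$3, J$1$3 - J$3$1, J$2$1 - J$1$2])"

text \<open>
  A condition at infinity is needed to exclude irrotational fields such as the constant field
  \<open>e_z\<close>, whose vorticity is zero.  The following one is implied by \<open>u(x) \<rightarrow> 0\<close> as
  \<open>|x| \<rightarrow> \<infinity>\<close> and, by Hoelder's inequality, by \<open>u \<in> L\<^sup>q\<close> for some \<open>1 \<le> q < \<infinity>\<close>
  (for instance by finite kinetic energy).  It also holds when \<open>u\<close> is given by the Biot-Savart law
  from a vorticity \<open>w e_\<theta>\<close> with \<open>w/r\<close> in \<open>L\<^sup>1\<close>.
\<close>

definition vanishes_at_infinity_in_mean :: "(real^3 \<Rightarrow> real^3) \<Rightarrow> bool" where
  "vanishes_at_infinity_in_mean u \<longleftrightarrow>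
     ((\<lambda>\<rho>. (LINT x:ball 0 \<rho>|lborel. norm (u x)) / measure lborel (ball (0::real^3) \<rho>)) \<longlongrightarrow> 0) at_top"

text \<open>The \<open>L\<^sup>p\<close> norm over \<open>S\<close>, with value \<open>\<infinity>\<close> outside \<open>L\<^sup>p(S)\<close>.\<close>

definition Lp_norm :: "real \<Rightarrow> (real^3) set \<Rightarrow> (real^3 \<Rightarrow> 'b::real_normed_vector) \<Rightarrow> ennreal" where
  "Lp_norm p S f = (let I = (\<integral>\<^sup>+x\<in>S. ennreal (norm (f x) powr p) \<partial>lborel) in
     if I = \<infinity> then \<infinity> else ennreal (enn2real I powr (1/p)))"

definition cylinder :: "real \<Rightarrow> (real^3) set" where
  "cylinder R = {x. (vector [x$1, x$2] :: real^2) \<in> ball 0 R \<and> x$3 \<in> {-R..R}}"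

text \<open>
  The function \<open>w/r\<close> on space; on the axis, a null set, division by zero makes it \<open>0\<close>.
\<close>

definition relative_vorticity :: "(real \<Rightarrow> real \<Rightarrow> real) \<Rightarrow> real^3 \<Rightarrow> real" where
  "relative_vorticity w x = w (cyl_radius x) (x$3) / cyl_radius x"

end

theory Submission
  imports Defs
begin

text \<open>
  Write \<open>r\<close> for the distance to the axis and \<open>f = |curl u| / r\<close>, which is \<open>|w / r|\<close> off the axis.
  Everything rests on a pointwise bound of Biot-Savart type,
  \<open>|u(x)| \<le> C \<integral> |curl u(y)| / |x - y|\<^sup>2 dy\<close>, that is, on the potential
  \<open>\<integral> f(y) r(y) / |x - y|\<^sup>2 dy\<close>.

  This kernel is too singular for the claimed exponent in three dimensions: the Riesz potential of
  order one maps \<open>L\<^sup>p\<close> only into the exponent \<open>3p / (3 - p)\<close>.  Axial symmetry makes the problem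
  two-dimensional.  Since \<open>f\<close> is invariant under rotations about the axis, the kernel may be replaced
  by its average over such rotations of \<open>y\<close>, and the average of \<open>r(y) / |x - y|\<^sup>2\<close> is at most a
  multiple of \<open>1 / \<rho>(x, y)\<close>, where \<open>\<rho>\<close> is the distance of the two points projected to the
  \<open>(r, z)\<close> half-plane (\<open>nn_integral_axisymmetric_le\<close>).  In a cylinder \<open>r < 2R\<close> a \<open>\<rho>\<close>-ball of radius
  \<open>\<delta>\<close> has volume \<open>O(R \<delta>\<^sup>2)\<close> (\<open>emeasure_meridional_ball_le\<close>), so \<open>1 / \<rho>\<close> is a weak \<open>L\<^sup>2\<close> kernel for
  Lebesgue measure there, and the Hardy-Littlewood-Sobolev inequality (\<open>HLS_bilinear\<close>) gives the
  exponent \<open>q = 2p / (2 - p)\<close>, that is \<open>1/q = 1/p - 1/2\<close>.  Points \<open>y\<close> with \<open>r(y) \<ge> 2R\<close> satisfy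
  \<open>r(y) / |x - y|\<^sup>2 \<le> 2 / R\<close> when \<open>r(x) < R\<close>, so their contribution is controlled by the \<open>L\<^sup>1\<close> norm of \<open>f\<close>.

  The Biot-Savart bound comes from testing \<open>u\<close> against radial fields.  For a radial field
  \<open>W\<close> of compact support, integration by parts and \<open>div u = 0\<close> turn \<open>\<integral> u\<^sub>i div W\<close> into an integral
  of \<open>curl u\<close> against \<open>W\<close> (\<open>radial_flux_identity\<close>).  Take for \<open>W\<close> the difference of two
  regularisations of \<open>y / |y|\<^sup>3\<close>, centred at \<open>x\<close>, at a small scale \<open>\<epsilon>\<close> and at a large scale \<open>L\<close>:
  outside the ball of radius \<open>L\<close> they cancel, \<open>|W(y)| = O(|y - x|\<^sup>-\<^sup>2)\<close>, and \<open>div W\<close> is a bump of scale \<open>\<epsilon>\<close>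
  minus a bump of scale \<open>L\<close>.  As \<open>\<epsilon> \<rightarrow> 0\<close> the first bump recovers a multiple of \<open>u\<^sub>i(x)\<close>; as \<open>L \<rightarrow> \<infinity>\<close>
  the contribution of the second one tends to zero, because the means of \<open>|u|\<close> over large balls do.
\<close>

section \<open>The Hardy-Littlewood-Sobolev inequality for weak \<open>L\<^sup>2\<close> kernels\<close>

lemma layer_cake_excess:
  fixes c :: ennreal and \<tau> :: real
  assumes "0 < \<tau>"
  shows "c - ennreal \<tau> = (\<integral>\<^sup>+t. indicator {\<tau><..} t * indicator {t. ennreal t < c} t \<partial>lborel)"
proof (cases c)
  case (real r)
  have "(\<integral>\<^sup>+t. indicator {\<tau><..} t * indicator {t. ennreal t < c} t \<partial>lborel) = (\<integral>\<^sup>+t. indicator {\<tau><..<r} t \<partial>lborel)"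
    using assms real by (intro nn_integral_cong) (auto simp: indicator_def ennreal_less_iff)
  also have "\<dots> = c - ennreal \<tau>"
    using assms real by (cases "\<tau> \<le> r") (auto simp: ennreal_minus ennreal_neg)
  finally show ?thesis ..
next
  case top
  have "(\<integral>\<^sup>+t. indicator {\<tau><..} t * indicator {t. ennreal t < c} t \<partial>lborel) = (\<integral>\<^sup>+t. indicator {\<tau><..} t \<partial>lborel)"
    using top by (intro nn_integral_cong) (auto simp: indicator_def)
  also have "\<dots> = \<infinity>"
  proof -
    have "ennreal (real n) \<le> emeasure lborel {\<tau><..}" for n
    proof -
      have "ennreal (real n) = emeasure lborel {\<tau><..<\<tau> + real n}" by simp
      also have "\<dots> \<le> emeasure lborel {\<tau><..}" by (intro emeasure_mono) auto
      finally show ?thesis .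
    qed
    then have "emeasure lborel {\<tau><..} = top"
      by (metis ennreal_of_nat_eq_real_of_nat ennreal_Ex_less_of_nat leD less_top)
    then show ?thesis by simp
  qed
  finally show ?thesis using top by simp
qed

text \<open>
  A function whose distribution function is \<open>O(t\<^sup>-\<^sup>2)\<close> becomes integrable after subtracting a positive
  level \<open>\<tau>\<close>: by the layer-cake formula the integral is at most \<open>\<integral>\<^sub>\<tau>\<^sup>\<infinity> A t\<^sup>-\<^sup>2 dt\<close>.
\<close>
lemma weak_L2_excess:
  assumes "sigma_finite_measure M" and [measurable]: "\<kappa> \<in> borel_measurable M"
    and dist: "\<And>t. 0 < t \<Longrightarrow> emeasure M {y\<in>space M. ennreal t < \<kappa> y} \<le> ennreal (A / t\<^sup>2)"
    and "0 \<le> A" "0 < \<tau>"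
  shows "(\<integral>\<^sup>+y. (\<kappa> y - ennreal \<tau>) \<partial>M) \<le> ennreal (A / \<tau>)"
proof -
  interpret sigma_finite_measure M by fact
  interpret pair_sigma_finite M "lborel :: real measure" ..
  have [measurable]: "Measurable.pred (M \<Otimes>\<^sub>M (lborel::real measure)) (\<lambda>p. ennreal (snd p) < \<kappa> (fst p))"
    by measurable
  have "(\<integral>\<^sup>+y. (\<kappa> y - ennreal \<tau>) \<partial>M)
      = (\<integral>\<^sup>+y. \<integral>\<^sup>+t. indicator {\<tau><..} t * indicator {p. ennreal (snd p) < \<kappa> (fst p)} (y, t) \<partial>lborel \<partial>M)"
    by (subst layer_cake_excess[OF \<open>0 < \<tau>\<close>]) (simp add: indicator_def)
  also have "\<dots> = (\<integral>\<^sup>+t. \<integral>\<^sup>+y. indicator {\<tau><..} t * indicator {p. ennreal (snd p) < \<kappa> (fst p)} (y, t) \<partial>M \<partial>lborel)"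
    by (rule Fubini'[symmetric]) measurable
  also have "\<dots> = (\<integral>\<^sup>+t. indicator {\<tau><..} t * emeasure M {y\<in>space M. ennreal t < \<kappa> y} \<partial>lborel)"
  proof (intro nn_integral_cong)
    fix t :: real
    have "(\<integral>\<^sup>+y. indicator {\<tau><..} t * indicator {p. ennreal (snd p) < \<kappa> (fst p)} (y, t) \<partial>M)
       = (\<integral>\<^sup>+y. indicator {\<tau><..} t * indicator {y\<in>space M. ennreal t < \<kappa> y} y \<partial>M)"
      by (intro nn_integral_cong) (auto simp: indicator_def)
    also have "\<dots> = indicator {\<tau><..} t * emeasure M {y\<in>space M. ennreal t < \<kappa> y}"
      by (subst nn_integral_cmult) auto
    finally show "(\<integral>\<^sup>+y. indicator {\<tau><..} t * indicator {p. ennreal (snd p) < \<kappa> (fst p)} (y, t) \<partial>M)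
      = indicator {\<tau><..} t * emeasure M {y\<in>space M. ennreal t < \<kappa> y}" .
  qed
  also have "\<dots> \<le> (\<integral>\<^sup>+t. ennreal (A / t\<^sup>2) * indicator {\<tau>..} t \<partial>lborel)"
    using dist \<open>0 < \<tau>\<close> by (intro nn_integral_mono) (auto simp: indicator_def)
  also have "\<dots> = ennreal (0 - (- (A / \<tau>)))"
  proof (rule nn_integral_FTC_atLeast)
    show "DERIV (\<lambda>t. - (A / t)) t :> A / t\<^sup>2" if "\<tau> \<le> t" for t
      using that \<open>0 < \<tau>\<close> by (auto intro!: derivative_eq_intros simp: power2_eq_square)
    show "((\<lambda>t. - (A / t)) \<longlongrightarrow> 0) at_top" 
      using tendsto_minus[OF tendsto_divide_0[OF tendsto_const[of A] filterlim_at_top_imp_at_infinity[OF filterlim_ident]]] by simp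
  qed (use \<open>0 \<le> A\<close> in auto)
  finally show ?thesis by simp
qed

lemma nn_integral_powr_from_0:
  fixes a c :: real
  assumes "-1 < a" "0 \<le> c"
  shows "(\<integral>\<^sup>+t\<in>{0..c}. ennreal (t powr a) \<partial>lborel) = ennreal (c powr (a + 1) / (a + 1))"
  using nn_integral_has_integral_lebesgue[OF _ has_integral_powr_from_0[OF assms]]
  by (simp add: nn_integral_completion ennreal_mult'' ennreal_indicator mult.commute)

text \<open>
  The one-sided half of the Hardy-Littlewood-Sobolev inequality.  Slicing \<open>min g b\<close> into its levels
  \<open>t < b\<close> and splitting \<open>\<kappa>\<close> at a height \<open>\<tau>(t)\<close> leaves \<open>\<tau>(t)\<close> on the set \<open>g \<ge> t\<close>, plus an excess whose
  integral is at most \<open>A / \<tau>(t)\<close>.  With \<open>\<tau>(t)\<close> proportional to \<open>t powr (s - 1)\<close> the first part sums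
  to at most a multiple of the integral of \<open>g powr s\<close>, and the second one converges at \<open>t = 0\<close> because \<open>s < 2\<close>.
\<close>
lemma truncated_weak_L2_bound:
  assumes M: "sigma_finite_measure M" and k[measurable]: "\<kappa> \<in> borel_measurable M"
    and g[measurable]: "g \<in> borel_measurable M" and g0: "\<And>y. 0 \<le> g y"
    and dist: "\<And>t. 0 < t \<Longrightarrow> emeasure M {y\<in>space M. ennreal t < \<kappa> y} \<le> ennreal (A / t\<^sup>2)"
    and A: "0 \<le> A" and s: "1 \<le> s" "s < 2" and b: "0 < b"
    and gs: "(\<integral>\<^sup>+y. ennreal (g y powr s) \<partial>M) \<le> 1"
  shows "(\<integral>\<^sup>+y. ennreal (min (g y) b) * \<kappa> y \<partial>M) \<le> ennreal ((1 + A / (2 - s)) * b powr (1 - s / 2))"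
proof -
  interpret sigma_finite_measure M by fact
  interpret pair_sigma_finite M "lborel :: real measure" ..
  \<comment> \<open>This factor makes the two contributions, of size \<open>\<tau>\<^sub>0\<close> and \<open>b powr (2 - s) / \<tau>\<^sub>0\<close>, scale alike in \<open>b\<close>.\<close>
  define \<tau>\<^sub>0 where "\<tau>\<^sub>0 = b powr (1 - s / 2)"
  define \<tau> where "\<tau> = (\<lambda>t. \<tau>\<^sub>0 * t powr (s - 1))"
  have \<tau>\<^sub>0: "0 < \<tau>\<^sub>0" using b by (simp add: \<tau>\<^sub>0_def)
  have [measurable]: "\<tau> \<in> borel_measurable borel" by (simp add: \<tau>_def)
  have point: "ennreal (min (g y) b) * \<kappa> y
      \<le> ennreal (\<tau>\<^sub>0 * g y powr s) + (\<integral>\<^sup>+t\<in>{0<..b}. (\<kappa> y - ennreal (\<tau> t)) \<partial>lborel)" for y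
  proof -
    have "ennreal (min (g y) b) * \<kappa> y = (\<integral>\<^sup>+t. \<kappa> y * indicator {0<..min (g y) b} t \<partial>lborel)"
      using g0[of y] b by (subst nn_integral_cmult) (auto simp: mult.commute)
    also have "\<dots> \<le> (\<integral>\<^sup>+t. ennreal (\<tau>\<^sub>0 * g y powr (s - 1)) * indicator {0<..g y} t
         + (\<kappa> y - ennreal (\<tau> t)) * indicator {0<..b} t \<partial>lborel)"
    proof (intro nn_integral_mono)
      fix t :: real
      show "\<kappa> y * indicator {0<..min (g y) b} t \<le> ennreal (\<tau>\<^sub>0 * g y powr (s - 1)) * indicator {0<..g y} t
         + (\<kappa> y - ennreal (\<tau> t)) * indicator {0<..b} t"
      proof (cases "0 < t \<and> t \<le> g y \<and> t \<le> b")
        case True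
        have "\<kappa> y \<le> ennreal (\<tau> t) + (\<kappa> y - ennreal (\<tau> t))"
          using ennreal_minus_le_iff[of "\<kappa> y" "ennreal (\<tau> t)" "\<kappa> y - ennreal (\<tau> t)"] by simp
        also have "\<dots> \<le> ennreal (\<tau>\<^sub>0 * g y powr (s - 1)) + (\<kappa> y - ennreal (\<tau> t))"
          using True s \<tau>\<^sub>0 by (intro add_right_mono ennreal_leI) (auto simp: \<tau>_def intro!: mult_left_mono powr_mono2)
        finally show ?thesis using True by simp
      qed (auto simp: indicator_def)
    qed
    also have "\<dots> = (\<integral>\<^sup>+t. ennreal (\<tau>\<^sub>0 * g y powr (s - 1)) * indicator {0<..g y} t \<partial>lborel)
        + (\<integral>\<^sup>+t\<in>{0<..b}. (\<kappa> y - ennreal (\<tau> t)) \<partial>lborel)"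
      by (intro nn_integral_add) measurable
    also have "(\<integral>\<^sup>+t. ennreal (\<tau>\<^sub>0 * g y powr (s - 1)) * indicator {0<..g y} t \<partial>lborel) = ennreal (\<tau>\<^sub>0 * g y powr s)"
      using g0[of y] \<tau>\<^sub>0
      by (cases "g y = 0") (auto simp: nn_integral_cmult ennreal_mult'[symmetric] powr_diff)
    finally show ?thesis .
  qed
  have [measurable]: "(\<lambda>p. (\<kappa> (fst p) - ennreal (\<tau> (snd p))) * indicator {0<..b} (snd p))
      \<in> borel_measurable (M \<Otimes>\<^sub>M (lborel :: real measure))"
    by measurable
  have "(\<integral>\<^sup>+y. ennreal (min (g y) b) * \<kappa> y \<partial>M)
      \<le> (\<integral>\<^sup>+y. ennreal (\<tau>\<^sub>0 * g y powr s) + (\<integral>\<^sup>+t\<in>{0<..b}. (\<kappa> y - ennreal (\<tau> t)) \<partial>lborel) \<partial>M)"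
    by (intro nn_integral_mono point)
  also have "\<dots> = (\<integral>\<^sup>+y. ennreal (\<tau>\<^sub>0 * g y powr s) \<partial>M)
      + (\<integral>\<^sup>+y. (\<integral>\<^sup>+t\<in>{0<..b}. (\<kappa> y - ennreal (\<tau> t)) \<partial>lborel) \<partial>M)"
    by (intro nn_integral_add) measurable
  also have "\<dots> \<le> ennreal \<tau>\<^sub>0 + ennreal (\<tau>\<^sub>0 * A / (2 - s))"
  proof (intro add_mono)
    have "(\<integral>\<^sup>+y. ennreal (\<tau>\<^sub>0 * g y powr s) \<partial>M) = ennreal \<tau>\<^sub>0 * (\<integral>\<^sup>+y. ennreal (g y powr s) \<partial>M)"
      using \<tau>\<^sub>0 by (subst nn_integral_cmult[symmetric]) (auto simp: ennreal_mult')
    also have "\<dots> \<le> ennreal \<tau>\<^sub>0 * 1" by (intro mult_left_mono gs) auto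
    finally show "(\<integral>\<^sup>+y. ennreal (\<tau>\<^sub>0 * g y powr s) \<partial>M) \<le> ennreal \<tau>\<^sub>0" by simp
    have "(\<integral>\<^sup>+y. (\<integral>\<^sup>+t\<in>{0<..b}. (\<kappa> y - ennreal (\<tau> t)) \<partial>lborel) \<partial>M)
        = (\<integral>\<^sup>+t. \<integral>\<^sup>+y. (\<kappa> y - ennreal (\<tau> t)) * indicator {0<..b} t \<partial>M \<partial>lborel)"
      using Fubini'[of "\<lambda>y t. (\<kappa> y - ennreal (\<tau> t)) * indicator {0<..b} t"]
      by (simp add: case_prod_unfold)
    also have "\<dots> = (\<integral>\<^sup>+t\<in>{0<..b}. (\<integral>\<^sup>+y. (\<kappa> y - ennreal (\<tau> t)) \<partial>M) \<partial>lborel)"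
      by (intro nn_integral_cong nn_integral_multc) measurable
    also have "\<dots> \<le> (\<integral>\<^sup>+t\<in>{0..b}. ennreal (A / \<tau>\<^sub>0) * ennreal (t powr (1 - s)) \<partial>lborel)"
    proof (intro nn_integral_mono)
      fix t :: real
      have "(\<integral>\<^sup>+y. (\<kappa> y - ennreal (\<tau> t)) \<partial>M) \<le> ennreal (A / \<tau> t)" if "0 < t"
        using that \<tau>\<^sub>0 by (intro weak_L2_excess M k dist A) (auto simp: \<tau>_def)
      moreover have "ennreal (A / \<tau> t) = ennreal (A / \<tau>\<^sub>0) * ennreal (t powr (1 - s))" if "0 < t"
        using that \<tau>\<^sub>0 A by (auto simp: \<tau>_def ennreal_mult[symmetric] powr_diff)
      ultimately show "(\<integral>\<^sup>+y. (\<kappa> y - ennreal (\<tau> t)) \<partial>M) * indicator {0<..b} t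
          \<le> ennreal (A / \<tau>\<^sub>0) * ennreal (t powr (1 - s)) * indicator {0..b} t"
        by (auto simp: indicator_def)
    qed
    also have "\<dots> = ennreal (A / \<tau>\<^sub>0) * (\<integral>\<^sup>+t\<in>{0..b}. ennreal (t powr (1 - s)) \<partial>lborel)"
      by (subst nn_integral_cmult[symmetric]) (auto simp: mult.assoc)
    also have "\<dots> = ennreal (A / \<tau>\<^sub>0 * (b powr (1 - s + 1) / (1 - s + 1)))"
      using s b A \<tau>\<^sub>0 by (subst nn_integral_powr_from_0) (auto simp: ennreal_mult[symmetric])
    also have "A / \<tau>\<^sub>0 * (b powr (1 - s + 1) / (1 - s + 1)) = \<tau>\<^sub>0 * A / (2 - s)"
    proof -
      have "b powr (1 - s + 1) = \<tau>\<^sub>0 * \<tau>\<^sub>0"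
        unfolding \<tau>\<^sub>0_def powr_add[symmetric] by simp
      then show ?thesis using \<tau>\<^sub>0 by simp
    qed
    finally show "(\<integral>\<^sup>+y. (\<integral>\<^sup>+t\<in>{0<..b}. (\<kappa> y - ennreal (\<tau> t)) \<partial>lborel) \<partial>M)
       \<le> ennreal (\<tau>\<^sub>0 * A / (2 - s))" .
  qed
  also have "\<dots> = ennreal ((1 + A / (2 - s)) * b powr (1 - s / 2))"
    using s A \<tau>\<^sub>0 by (subst ennreal_plus[symmetric]) (auto simp: \<tau>\<^sub>0_def algebra_simps)
  finally show ?thesis .
qed

text \<open>
  Where \<open>h(y) \<le> f(x) powr (p / r)\<close>, the function \<open>h\<close> is in effect truncated at a level depending on
  \<open>x\<close>, so that \<open>truncated_weak_L2_bound\<close> applies to the integral over \<open>y\<close>; elsewhere \<open>f\<close> is truncated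
  at a level depending on \<open>y\<close>.  The relation between \<open>p\<close> and \<open>r\<close> makes the remaining outer integrands
  exactly \<open>f powr p\<close> and \<open>h powr r\<close>.
\<close>
lemma HLS_bilinear_normalized:
  assumes M: "sigma_finite_measure M"
    and k[measurable]: "(\<lambda>z. k (fst z) (snd z)) \<in> borel_measurable (M \<Otimes>\<^sub>M M)"
    and sym: "\<And>x y. k x y = k y x"
    and dist: "\<And>x t. x \<in> space M \<Longrightarrow> 0 < t \<Longrightarrow>
      emeasure M {y\<in>space M. ennreal t < k x y} \<le> ennreal (A / t\<^sup>2)"
    and A: "0 \<le> A" and p: "1 \<le> p" "p < 2" and r: "1 \<le> r" "r < 2" and pr: "1 / p + 1 / r = 3 / 2"
    and f[measurable]: "f \<in> borel_measurable M" and f0: "\<And>y. 0 \<le> f y"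
    and h[measurable]: "h \<in> borel_measurable M" and h0: "\<And>y. 0 \<le> h y"
    and fp: "(\<integral>\<^sup>+y. ennreal (f y powr p) \<partial>M) \<le> 1"
    and hr: "(\<integral>\<^sup>+y. ennreal (h y powr r) \<partial>M) \<le> 1"
  shows "(\<integral>\<^sup>+x. \<integral>\<^sup>+y. ennreal (f x * h y) * k x y \<partial>M \<partial>M)
      \<le> ennreal (2 + A / (2 - p) + A / (2 - r))"
proof -
  interpret sigma_finite_measure M by fact
  interpret pair_sigma_finite M M ..
  have kx[measurable]: "k x \<in> borel_measurable M" if "x \<in> space M" for x
    using measurable_compose[OF measurable_Pair1'[OF that] k] by simp
  have half: "(\<integral>\<^sup>+x. \<integral>\<^sup>+y. ennreal (a x * min (b y) (a x powr (s / s'))) * k x y \<partial>M \<partial>M)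
      \<le> ennreal (1 + A / (2 - s'))"
    if [measurable]: "a \<in> borel_measurable M" "b \<in> borel_measurable M"
      and a0: "\<And>y. 0 \<le> a y" and b0: "\<And>y. 0 \<le> b y"
      and s: "1 \<le> s" "1 \<le> s'" "s' < 2" "1 / s + 1 / s' = 3 / 2"
      and as: "(\<integral>\<^sup>+y. ennreal (a y powr s) \<partial>M) \<le> 1"
      and bs: "(\<integral>\<^sup>+y. ennreal (b y powr s') \<partial>M) \<le> 1" for a b s s'
  proof -
    have "(\<integral>\<^sup>+y. ennreal (a x * min (b y) (a x powr (s / s'))) * k x y \<partial>M)
        \<le> ennreal (1 + A / (2 - s')) * ennreal (a x powr s)" if x: "x \<in> space M" for x
    proof (cases "a x = 0")
      case False
      with a0[of x] have ax: "0 < a x" by (simp add: less_le)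
      have "(\<integral>\<^sup>+y. ennreal (a x * min (b y) (a x powr (s / s'))) * k x y \<partial>M)
          = ennreal (a x) * (\<integral>\<^sup>+y. ennreal (min (b y) (a x powr (s / s'))) * k x y \<partial>M)"
        using kx[OF x] ax b0 by (subst nn_integral_cmult[symmetric]) (auto simp: ennreal_mult mult.assoc)
      also have "\<dots> \<le> ennreal (a x) * ennreal ((1 + A / (2 - s')) * (a x powr (s / s')) powr (1 - s' / 2))"
        using kx[OF x] ax b0 A s bs dist[OF x]
        by (intro mult_left_mono truncated_weak_L2_bound M) auto
      also have "\<dots> = ennreal (1 + A / (2 - s')) * ennreal (a x powr s)"
      proof -
        have "1 + s / s' * (1 - s' / 2) = s * (1 / s + 1 / s' - 1 / 2)"
          using s by (simp add: field_simps)
        also have "\<dots> = s" using s by simp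
        finally have "a x * (a x powr (s / s')) powr (1 - s' / 2) = a x powr s"
          using ax by (metis powr_add powr_one powr_powr less_imp_le)
        then show ?thesis
          using ax A s by (simp add: ennreal_mult'[symmetric] mult.left_commute del: ennreal_plus)
      qed
      finally show ?thesis .
    qed simp
    then have "(\<integral>\<^sup>+x. \<integral>\<^sup>+y. ennreal (a x * min (b y) (a x powr (s / s'))) * k x y \<partial>M \<partial>M)
        \<le> (\<integral>\<^sup>+x. ennreal (1 + A / (2 - s')) * ennreal (a x powr s) \<partial>M)"
      by (intro nn_integral_mono)
    also have "\<dots> = ennreal (1 + A / (2 - s')) * (\<integral>\<^sup>+x. ennreal (a x powr s) \<partial>M)"
      by (intro nn_integral_cmult) measurable
    also have "\<dots> \<le> ennreal (1 + A / (2 - s')) * 1"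
      by (intro mult_left_mono as) auto
    finally show ?thesis by simp
  qed
  have point: "ennreal (f x * h y) * k x y
      \<le> ennreal (f x * min (h y) (f x powr (p / r))) * k x y
        + ennreal (h y * min (f x) (h y powr (r / p))) * k x y" for x y
  proof (cases "h y \<le> f x powr (p / r)")
    case True
    then show ?thesis by simp
  next
    case False
    then have "f x powr (p / r) \<le> h y" by simp
    then have "(f x powr (p / r)) powr (r / p) \<le> h y powr (r / p)"
      using p r by (intro powr_mono2) auto
    then have "f x \<le> h y powr (r / p)"
      using p r f0[of x] by (simp add: powr_powr)
    then show ?thesis by (simp add: mult.commute)
  qed
  have "(\<integral>\<^sup>+x. \<integral>\<^sup>+y. ennreal (f x * h y) * k x y \<partial>M \<partial>M)
      \<le> (\<integral>\<^sup>+x. \<integral>\<^sup>+y. ennreal (f x * min (h y) (f x powr (p / r))) * k x y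
        + ennreal (h y * min (f x) (h y powr (r / p))) * k x y \<partial>M \<partial>M)"
    by (intro nn_integral_mono point)
  also have "\<dots> = (\<integral>\<^sup>+x. (\<integral>\<^sup>+y. ennreal (f x * min (h y) (f x powr (p / r))) * k x y \<partial>M)
        + (\<integral>\<^sup>+y. ennreal (h y * min (f x) (h y powr (r / p))) * k x y \<partial>M) \<partial>M)"
    by (intro nn_integral_cong nn_integral_add) measurable
  also have "\<dots> = (\<integral>\<^sup>+x. \<integral>\<^sup>+y. ennreal (f x * min (h y) (f x powr (p / r))) * k x y \<partial>M \<partial>M)
        + (\<integral>\<^sup>+x. \<integral>\<^sup>+y. ennreal (h y * min (f x) (h y powr (r / p))) * k x y \<partial>M \<partial>M)"
    by (intro nn_integral_add) measurable
  also have "(\<integral>\<^sup>+x. \<integral>\<^sup>+y. ennreal (h y * min (f x) (h y powr (r / p))) * k x y \<partial>M \<partial>M)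
      = (\<integral>\<^sup>+y. \<integral>\<^sup>+x. ennreal (h y * min (f x) (h y powr (r / p))) * k y x \<partial>M \<partial>M)"
    by (subst Fubini') (auto simp: sym intro!: nn_integral_cong arg_cong2[where f="(*)"])
  also have "(\<integral>\<^sup>+x. \<integral>\<^sup>+y. ennreal (f x * min (h y) (f x powr (p / r))) * k x y \<partial>M \<partial>M) + \<dots>
      \<le> ennreal (1 + A / (2 - r)) + ennreal (1 + A / (2 - p))"
    using p r pr by (intro add_mono half fp hr f0 h0 f h) auto
  also have "\<dots> = ennreal (2 + A / (2 - p) + A / (2 - r))"
    using A p r by (subst ennreal_plus[symmetric]) auto
  finally show ?thesis .
qed

text \<open>
  The Hardy-Littlewood-Sobolev inequality, with a symmetric kernel that is uniformly in weak \<open>L\<^sup>2\<close> in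
  place of \<open>1 / |x - y|\<close> on the plane.  It follows from the normalised case by homogeneity.
\<close>
lemma HLS_bilinear:
  assumes M: "sigma_finite_measure M"
    and k[measurable]: "(\<lambda>z. k (fst z) (snd z)) \<in> borel_measurable (M \<Otimes>\<^sub>M M)"
    and sym: "\<And>x y. k x y = k y x"
    and dist: "\<And>x t. x \<in> space M \<Longrightarrow> 0 < t \<Longrightarrow>
      emeasure M {y\<in>space M. ennreal t < k x y} \<le> ennreal (A / t\<^sup>2)"
    and A: "0 \<le> A" and p: "1 \<le> p" "p < 2" and r: "1 \<le> r" "r < 2" and pr: "1 / p + 1 / r = 3 / 2"
    and f[measurable]: "f \<in> borel_measurable M" and f0: "\<And>y. 0 \<le> f y"
    and h[measurable]: "h \<in> borel_measurable M" and h0: "\<And>y. 0 \<le> h y"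
    and P: "0 < P" and H: "0 < H"
    and fp: "(\<integral>\<^sup>+y. ennreal (f y powr p) \<partial>M) \<le> ennreal (P powr p)"
    and hr: "(\<integral>\<^sup>+y. ennreal (h y powr r) \<partial>M) \<le> ennreal (H powr r)"
  shows "(\<integral>\<^sup>+x. \<integral>\<^sup>+y. ennreal (f x * h y) * k x y \<partial>M \<partial>M)
      \<le> ennreal ((2 + A / (2 - p) + A / (2 - r)) * P * H)"
proof -
  interpret sigma_finite_measure M by fact
  have kx[measurable]: "k x \<in> borel_measurable M" if "x \<in> space M" for x
    using measurable_compose[OF measurable_Pair1'[OF that] k] by simp
  have norm1: "(\<integral>\<^sup>+y. ennreal ((a y / c) powr s) \<partial>M) \<le> 1"
    if "0 < c" "\<And>y. 0 \<le> a y" "(\<integral>\<^sup>+y. ennreal (a y powr s) \<partial>M) \<le> ennreal (c powr s)"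
      and [measurable]: "a \<in> borel_measurable M" for a c s
  proof -
    have "(\<integral>\<^sup>+y. ennreal ((a y / c) powr s) \<partial>M) = (\<integral>\<^sup>+y. ennreal (1 / c powr s) * ennreal (a y powr s) \<partial>M)"
      using that by (simp add: powr_divide ennreal_mult'[symmetric])
    also have "\<dots> = ennreal (1 / c powr s) * (\<integral>\<^sup>+y. ennreal (a y powr s) \<partial>M)"
      by (intro nn_integral_cmult) measurable
    also have "\<dots> \<le> ennreal (1 / c powr s) * ennreal (c powr s)"
      by (intro mult_left_mono that) auto
    also have "\<dots> = 1" using that by (simp add: ennreal_mult'[symmetric])
    finally show ?thesis .
  qed
  have "(\<integral>\<^sup>+x. \<integral>\<^sup>+y. ennreal (f x * h y) * k x y \<partial>M \<partial>M)
      = (\<integral>\<^sup>+x. ennreal (P * H) * (\<integral>\<^sup>+y. ennreal (f x / P * (h y / H)) * k x y \<partial>M) \<partial>M)"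
    using P H f0 h0
    by (intro nn_integral_cong, subst nn_integral_cmult[symmetric])
       (auto simp: mult.assoc[symmetric] ennreal_mult[symmetric])
  also have "\<dots> = ennreal (P * H) * (\<integral>\<^sup>+x. \<integral>\<^sup>+y. ennreal (f x / P * (h y / H)) * k x y \<partial>M \<partial>M)"
    by (intro nn_integral_cmult) measurable
  also have "\<dots> \<le> ennreal (P * H) * ennreal (2 + A / (2 - p) + A / (2 - r))"
    using P H f0 h0 by (intro mult_left_mono HLS_bilinear_normalized M k sym dist A p r pr norm1 fp hr) auto
  also have "\<dots> = ennreal ((2 + A / (2 - p) + A / (2 - r)) * P * H)"
    using P H p r A by (subst ennreal_mult[symmetric]) (auto simp: algebra_simps)
  finally show ?thesis .
qed

section \<open>Integration by parts against a radial field\<close>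

lemma integral_lborel_shift:
  fixes g :: "'a::euclidean_space \<Rightarrow> real"
  assumes [measurable]: "g \<in> borel_measurable borel"
  shows "(\<integral>y. g (y + c) \<partial>lborel) = (\<integral>y. g y \<partial>lborel)"
proof -
  have "(\<integral>y. g y \<partial>lborel) = (\<integral>y. g y \<partial>(distr lborel borel ((+) c)))"
    by (simp add: lborel_distr_plus)
  also have "\<dots> = (\<integral>y. g (c + y) \<partial>lborel)" by (intro integral_distr) auto
  finally show ?thesis by (simp add: add.commute)
qed

lemma integrable_lborel_shift:
  fixes g :: "'a::euclidean_space \<Rightarrow> real"
  assumes "integrable lborel g"
  shows "integrable lborel (\<lambda>y. g (y + c))"
proof -
  have "integrable (distr lborel borel ((+) c)) g"
    using assms by (simp add: lborel_distr_plus)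
  then have "integrable lborel (\<lambda>y. g (c + y))" by (subst (asm) integrable_distr_eq) (use borel_measurable_integrable[OF assms] in auto)
  then show ?thesis by (simp add: add.commute)
qed

lemma integrable_continuous_compact_support:
  fixes g :: "'a::euclidean_space \<Rightarrow> real"
  assumes "continuous_on UNIV g" "\<And>y. B < norm y \<Longrightarrow> g y = 0"
  shows "integrable lborel g"
proof -
  have "integrable lborel (\<lambda>x. indicator (cball 0 B) x *\<^sub>R g x)"
    by (intro borel_integrable_compact continuous_on_subset[OF assms(1)]) auto
  also have "(\<lambda>x. indicator (cball 0 B) x *\<^sub>R g x) = g"
    using assms(2) by (force simp: indicator_def)
  finally show ?thesis .
qed

text \<open>
  The difference quotients of \<open>g\<close> have integral zero by translation invariance of Lebesgue measure, and
  they converge dominatedly to the directional derivative.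
\<close>
lemma integral_directional_derivative_eq_0:
  fixes g g' :: "'a::euclidean_space \<Rightarrow> real"
  assumes der: "\<And>y. ((\<lambda>t. g (y + t *\<^sub>R e)) has_real_derivative g' y) (at 0)"
    and cont: "continuous_on UNIV g" "continuous_on UNIV g'"
    and supp: "\<And>y. B < norm y \<Longrightarrow> g y = 0"
  shows "integrable lborel g'" "(\<integral>y. g' y \<partial>lborel) = 0"
proof -
  have supp': "g' y = 0" if y: "B < norm y" for y
  proof -
    have op: "open {t. B < norm (y + t *\<^sub>R e)}" by (intro open_Collect_less continuous_intros)
    have "((\<lambda>t. g (y + t *\<^sub>R e)) has_real_derivative 0) (at 0)"
      by (rule has_field_derivative_transform_within_open[OF _ op, of "\<lambda>_. 0"]) (use y supp in auto)
    with der show ?thesis by (rule DERIV_unique)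
  qed
  show int: "integrable lborel g'"
    by (rule integrable_continuous_compact_support[OF cont(2) supp'])
  have intg: "integrable lborel g"
    by (rule integrable_continuous_compact_support[OF cont(1) supp])
  have [measurable]: "g \<in> borel_measurable borel" "g' \<in> borel_measurable borel"
    using cont by (auto intro: borel_measurable_continuous_onI)
  obtain M where M: "\<And>y. \<bar>g' y\<bar> \<le> M" and "0 \<le> M"
  proof -
    have "compact (g' ` cball 0 B)"
      by (intro compact_continuous_image continuous_on_subset[OF cont(2)]) auto
    then obtain M where "\<forall>z\<in>g' ` cball 0 B. norm z \<le> M"
      using compact_imp_bounded bounded_iff by blast
    then have M: "\<bar>g' y\<bar> \<le> M" if "y \<in> cball 0 B" for y using that by simp
    have "\<bar>g' y\<bar> \<le> max M 0" for y
      using M[of y] supp'[of y] by (cases "norm y \<le> B") auto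
    then show ?thesis by (intro that[of "max M 0"]) auto
  qed
  define D where "D = (\<lambda>n y. (g (y + inverse (real (Suc n)) *\<^sub>R e) - g y) / inverse (real (Suc n)))"
  have dert: "((\<lambda>t. g (y + t *\<^sub>R e)) has_real_derivative g' (y + t *\<^sub>R e)) (at t)" for y t
    using der[of "y + t *\<^sub>R e"] DERIV_shift[of "\<lambda>s. g (y + s *\<^sub>R e)" "g' (y + t *\<^sub>R e)" 0 t]
    by (simp add: algebra_simps)
  have bound: "norm (D n y) \<le> M * indicator (cball 0 (B + norm e)) y" for n y
  proof (cases "norm y \<le> B + norm e")
    case True
    have "\<exists>z>0. z < inverse (real (Suc n)) \<and> g (y + inverse (real (Suc n)) *\<^sub>R e) - g (y + 0 *\<^sub>R e)
        = (inverse (real (Suc n)) - 0) * g' (y + z *\<^sub>R e)"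
      by (rule MVT2) (auto intro: dert)
    then obtain z where "g (y + inverse (real (Suc n)) *\<^sub>R e) - g y = inverse (real (Suc n)) * g' (y + z *\<^sub>R e)"
      by auto
    then have "D n y = g' (y + z *\<^sub>R e)" by (simp add: D_def)
    then show ?thesis using M True by simp
  next
    case False
    have "norm (inverse (real (Suc n)) *\<^sub>R e) \<le> 1 * norm e"
      unfolding norm_scaleR by (intro mult_right_mono) (auto simp: field_simps)
    then have "B < norm (y + inverse (real (Suc n)) *\<^sub>R e)"
      using False norm_diff_ineq[of y "inverse (real (Suc n)) *\<^sub>R e"] by linarith
    moreover have "B < norm y" using False norm_ge_zero[of e] by linarith
    ultimately show ?thesis using supp \<open>0 \<le> M\<close> by (simp add: D_def)
  qed
  have "(\<lambda>n. \<integral>y. D n y \<partial>lborel) \<longlonglongrightarrow> (\<integral>y. g' y \<partial>lborel)"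
  proof (rule integral_dominated_convergence)
    show "integrable lborel (\<lambda>y. M * indicator (cball 0 (B + norm e)) y :: real)"
      by (intro integrable_mult_right) (auto intro!: integrable_real_indicator emeasure_lborel_cball_finite)
    show "AE y in lborel. (\<lambda>n. D n y) \<longlonglongrightarrow> g' y"
    proof (intro always_eventually allI)
      fix y
      have "((\<lambda>h. (g (y + (0 + h) *\<^sub>R e) - g (y + 0 *\<^sub>R e)) / h) \<longlongrightarrow> g' y) (at 0)"
        using der[of y] unfolding DERIV_def .
      then have "((\<lambda>h. (g (y + h *\<^sub>R e) - g y) / h) \<longlongrightarrow> g' y) (at 0)" by simp
      moreover have "filterlim (\<lambda>n. inverse (real (Suc n))) (at 0) sequentially"
        unfolding filterlim_at using LIMSEQ_inverse_real_of_nat by auto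
      ultimately show "(\<lambda>n. D n y) \<longlonglongrightarrow> g' y"
        unfolding D_def by (rule filterlim_compose)
    qed
    show "AE y in lborel. norm (D n y) \<le> M * indicator (cball 0 (B + norm e)) y" for n
      using bound by simp
  qed (auto simp: D_def)
  moreover have "(\<integral>y. D n y \<partial>lborel) = 0" for n
  proof -
    have "(\<integral>y. D n y \<partial>lborel)
        = ((\<integral>y. g (y + inverse (real (Suc n)) *\<^sub>R e) \<partial>lborel) - (\<integral>y. g y \<partial>lborel)) / inverse (real (Suc n))"
      unfolding D_def using intg integrable_lborel_shift[OF intg] by simp
    then show ?thesis by (simp add: integral_lborel_shift)
  qed
  ultimately show "(\<integral>y. g' y \<partial>lborel) = 0"
    using LIMSEQ_unique[OF _ tendsto_const] by fastforce
qed

text \<open>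
  Let \<open>W(y) = G(|y - x|\<^sup>2) (y - x)\<close>, so that \<open>div W = 2 \<sigma> G' + n G\<close> with \<open>\<sigma> = |y - x|\<^sup>2\<close>.  Being radial, \<open>W\<close> has a symmetric Jacobian, and therefore,
  when \<open>div u = 0\<close>,
  \<open>\<Sum>\<^sub>j (\<partial>\<^sub>i(u\<^sub>j W\<^sub>j) - \<partial>\<^sub>j(u\<^sub>j W\<^sub>i) - \<partial>\<^sub>j(u\<^sub>i W\<^sub>j)) = \<Sum>\<^sub>j (\<partial>\<^sub>i u\<^sub>j - \<partial>\<^sub>j u\<^sub>i) W\<^sub>j - u\<^sub>i div W\<close>.
  The left-hand side has integral zero.
\<close>
lemma radial_flux_identity:
  fixes u :: "real^'n \<Rightarrow> real^'n" and J :: "real^'n \<Rightarrow> real^'n^'n" and x :: "real^'n"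
    and \<sigma> :: "real^'n \<Rightarrow> real"
    and G G' :: "real \<Rightarrow> real"
  assumes der: "\<And>y a k. ((\<lambda>t. u (y + t *\<^sub>R axis k 1) $ a) has_real_derivative J y $ a $ k) (at 0)"
    and contJ: "\<And>a k. continuous_on UNIV (\<lambda>y. J y $ a $ k)"
    and contu: "continuous_on UNIV u"
    and div0: "\<And>y. trace (J y) = 0"
    and G: "\<And>s. (G has_real_derivative G' s) (at s)" "continuous_on UNIV G'"
    and supp: "\<And>s. B\<^sup>2 \<le> s \<Longrightarrow> G s = 0" and B: "0 \<le> B"
  defines "\<sigma> \<equiv> \<lambda>y. (y - x) \<bullet> (y - x)"
  shows "(\<integral>y. u y $ i * (2 * \<sigma> y * G' (\<sigma> y) + CARD('n) * G (\<sigma> y)) \<partial>lborel)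
    = (\<integral>y. G (\<sigma> y) * (\<Sum>j\<in>UNIV. (J y $ j $ i - J y $ i $ j) * (y - x) $ j) \<partial>lborel)"
proof -
  \<comment> \<open>The derivative of \<open>u\<^sub>a W\<^sub>b\<close> in the direction \<open>k\<close>.\<close>
  define D where "D = (\<lambda>a b k y. J y $ a $ k * (G (\<sigma> y) * (y - x) $ b)
     + u y $ a * (2 * G' (\<sigma> y) * (y - x) $ k * (y - x) $ b + G (\<sigma> y) * (if k = b then 1 else 0)))"
  have contG: "continuous_on UNIV G"
    using G(1) by (intro DERIV_continuous_on) (auto intro: has_field_derivative_at_within)
  have cont\<sigma>: "continuous_on UNIV \<sigma>" unfolding \<sigma>_def by (intro continuous_intros)
  have contG\<sigma>: "continuous_on UNIV (\<lambda>y. G (\<sigma> y))" "continuous_on UNIV (\<lambda>y. G' (\<sigma> y))"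
    using continuous_on_compose2[OF contG cont\<sigma>] continuous_on_compose2[OF G(2) cont\<sigma>] by auto
  have supp\<sigma>: "G (\<sigma> y) = 0" if "norm x + B < norm y" for y
  proof -
    have "B \<le> norm (y - x)" using that norm_triangle_ineq2[of y x] by linarith
    then show ?thesis using B by (intro supp) (auto simp: \<sigma>_def dot_square_norm intro: power_mono)
  qed
  have dG: "((\<lambda>t. G (\<sigma> (y + t *\<^sub>R axis k 1)) * (y + t *\<^sub>R axis k 1 - x) $ b) has_real_derivative
      (2 * G' (\<sigma> y) * (y - x) $ k * (y - x) $ b + G (\<sigma> y) * (if k = b then 1 else 0))) (at 0)" for y k b
  proof -
    have 1: "\<sigma> (y + t *\<^sub>R axis k 1) = \<sigma> y + 2 * t * (y - x) $ k + t\<^sup>2" for t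
      unfolding \<sigma>_def
      by (simp add: inner_add_left inner_add_right inner_diff_left inner_diff_right inner_axis inner_axis'
          inner_axis_axis power2_eq_square algebra_simps inner_commute)
    have 2: "((\<lambda>t. \<sigma> y + 2 * t * (y - x) $ k + t\<^sup>2) has_real_derivative 2 * (y - x) $ k) (at 0)"
      by (auto intro!: derivative_eq_intros)
    have 3: "((\<lambda>t. G (\<sigma> y + 2 * t * (y - x) $ k + t\<^sup>2)) has_real_derivative G' (\<sigma> y) * (2 * (y - x) $ k)) (at 0)"
      using DERIV_chain2[OF _ 2, of G "G' (\<sigma> y)"] G(1)[of "\<sigma> y"] by simp
    have 4: "((\<lambda>t. (y + t *\<^sub>R axis k 1 - x) $ b) has_real_derivative (if k = b then 1 else 0)) (at 0)"
      by (auto intro!: derivative_eq_intros simp: axis_def)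
    show ?thesis unfolding 1
      by (rule DERIV_cong[OF DERIV_mult[OF 3 4]]) (simp add: axis_def)
  qed
  have D: "integrable lborel (D a b k)" "(\<integral>y. D a b k y \<partial>lborel) = 0" for a b k
  proof -
    have 1: "((\<lambda>t. u (y + t *\<^sub>R axis k 1) $ a * (G (\<sigma> (y + t *\<^sub>R axis k 1)) * (y + t *\<^sub>R axis k 1 - x) $ b))
       has_real_derivative D a b k y) (at 0)" for y
      by (rule DERIV_cong[OF DERIV_mult[OF der dG]]) (simp add: D_def)
    have 2: "continuous_on UNIV (\<lambda>y. u y $ a * (G (\<sigma> y) * (y - x) $ b))"
      by (intro continuous_intros contu contG\<sigma>)
    have 3: "continuous_on UNIV (D a b k)"
      unfolding D_def by (intro continuous_intros contu contG\<sigma> contJ)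
    have 4: "u y $ a * (G (\<sigma> y) * (y - x) $ b) = 0" if "norm x + B < norm y" for y
      using supp\<sigma>[OF that] by simp
    show "integrable lborel (D a b k)" "(\<integral>y. D a b k y \<partial>lborel) = 0"
      using integral_directional_derivative_eq_0[OF 1 2 3 4] by auto
  qed
  have supp': "2 * \<sigma> y * G' (\<sigma> y) + CARD('n) * G (\<sigma> y) = 0" if "norm x + B < norm y" for y
  proof -
    have *: "B\<^sup>2 < \<sigma> y"
    proof -
      have "B < norm (y - x)" using that norm_triangle_ineq2[of y x] by linarith
      then show ?thesis using B by (auto simp: \<sigma>_def dot_square_norm intro: power_strict_mono)
    qed
    have "(G has_real_derivative 0) (at (\<sigma> y))"
      by (rule has_field_derivative_transform_within_open[of "\<lambda>_. 0" _ _ "{B\<^sup>2<..}"]) (use * supp in auto)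
    then have "G' (\<sigma> y) = 0" using G(1) DERIV_unique by blast
    then show ?thesis using supp\<sigma>[OF that] by simp
  qed
  have point: "(\<Sum>j\<in>UNIV. D j j i y - D j i j y - D i j j y)
      = G (\<sigma> y) * (\<Sum>j\<in>UNIV. (J y $ j $ i - J y $ i $ j) * (y - x) $ j)
        - u y $ i * (2 * \<sigma> y * G' (\<sigma> y) + CARD('n) * G (\<sigma> y))" for y
  proof -
    have "(\<Sum>j\<in>UNIV. D j j i y - D j i j y - D i j j y)
       = (\<Sum>j\<in>UNIV. G (\<sigma> y) * ((J y $ j $ i - J y $ i $ j) * (y - x) $ j)
          - (G (\<sigma> y) * (y - x) $ i) * J y $ j $ j - (2 * u y $ i * G' (\<sigma> y)) * ((y - x) $ j * (y - x) $ j)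
          - u y $ i * G (\<sigma> y))"
      by (intro sum.cong refl) (auto simp: D_def algebra_simps)
    also have "\<dots> = G (\<sigma> y) * (\<Sum>j\<in>UNIV. (J y $ j $ i - J y $ i $ j) * (y - x) $ j)
        - (G (\<sigma> y) * (y - x) $ i) * trace (J y) - (2 * u y $ i * G' (\<sigma> y)) * \<sigma> y
        - u y $ i * (CARD('n) * G (\<sigma> y))"
      by (simp only: sum_subtractf sum_distrib_left[symmetric] trace_def \<sigma>_def inner_vec_def inner_real_def sum_constant)
    finally show ?thesis using div0 by (simp add: algebra_simps)
  qed
  have contJ': "continuous_on UNIV (\<lambda>y. \<Sum>j\<in>UNIV. (J y $ j $ i - J y $ i $ j) * (y - x) $ j)"
    by (intro continuous_intros contJ)
  have "(\<integral>y. (\<Sum>j\<in>UNIV. D j j i y - D j i j y - D i j j y) \<partial>lborel) = 0"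
    using D by (subst Bochner_Integration.integral_sum) auto
  moreover have "integrable lborel (\<lambda>y. G (\<sigma> y) * (\<Sum>j\<in>UNIV. (J y $ j $ i - J y $ i $ j) * (y - x) $ j))"
    by (rule integrable_continuous_compact_support[of _ "norm x + B"])
       (use supp\<sigma> in \<open>auto intro!: continuous_intros contG\<sigma> contJ\<close>)
  moreover have "integrable lborel (\<lambda>y. u y $ i * (2 * \<sigma> y * G' (\<sigma> y) + CARD('n) * G (\<sigma> y)))"
    by (rule integrable_continuous_compact_support[of _ "norm x + B"])
       (use supp' in \<open>auto intro!: continuous_intros contG\<sigma> contu cont\<sigma>\<close>)
  ultimately show ?thesis
    unfolding point by simp
qed

section \<open>A regularised Newtonian field\<close>

text \<open>
  The field \<open>y / |y|\<^sup>3\<close> is \<open>t powr (- 3 / 2)\<close> times \<open>y\<close> for \<open>t = |y|\<^sup>2\<close>.  Below \<open>t = 1\<close> the factor is replaced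
  by its tangent at \<open>1\<close>, which keeps the field continuously differentiable and makes it regular at the
  origin.
\<close>
definition newton_profile :: "real \<Rightarrow> real" where
  "newton_profile t = (if t < 1 then (5 - 3 * t) / 2 else t powr (- 3 / 2))"

lemma DERIV_newton_profile:
  "(newton_profile has_real_derivative - (3 / 2) * max t 1 powr (- 5 / 2)) (at t)"
proof -
  have "((\<lambda>t. if t \<in> {..<1} then (5 - 3 * t) / 2 else t powr (- 3 / 2)) has_vector_derivative
      (if t \<in> {..<1} then - (3 / 2) else - (3 / 2) * t powr (- 5 / 2))) (at t within UNIV)"
  proof (rule has_vector_derivative_If_within_closures[where T = "{1..}"])
    fix t :: real
    show "((\<lambda>t. (5 - 3 * t) / 2) has_vector_derivative - (3 / 2)) (at t within {..<1} \<union> (closure {..<1} \<inter> closure {1..}))"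
      unfolding has_real_derivative_iff_has_vector_derivative[symmetric]
      by (auto intro!: derivative_eq_intros)
    assume "t \<in> {1..} \<union> (closure {..<1} \<inter> closure {1..})"
    then have "0 < t" by auto
    then show "((\<lambda>t. t powr (- 3 / 2)) has_vector_derivative - (3 / 2) * t powr (- 5 / 2))
        (at t within {1..} \<union> (closure {..<1} \<inter> closure {1..}))"
      unfolding has_real_derivative_iff_has_vector_derivative[symmetric]
      by (auto intro!: derivative_eq_intros)
  qed auto
  moreover have "(if t \<in> {..<1} then - (3 / 2) else - (3 / 2) * t powr (- 5 / 2)) = - (3 / 2) * max t 1 powr (- 5 / 2)"
    by (auto simp: max_def)
  ultimately show ?thesis
    unfolding has_real_derivative_iff_has_vector_derivative newton_profile_def[abs_def] lessThan_iff by simp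
qed

text \<open>
  The divergence of the regularised field, as a function of \<open>t = |y|\<^sup>2\<close>: a continuous bump supported in the
  unit ball, since \<open>y / |y|\<^sup>3\<close> itself is divergence free.
\<close>
lemma newton_profile_divergence:
  "3 * newton_profile t + 2 * t * (- (3 / 2) * max t 1 powr (- 5 / 2)) = 15 / 2 * max 0 (1 - t)"
proof (cases "t < 1")
  case True
  then show ?thesis by (simp add: newton_profile_def field_simps)
next
  case False
  then have "t * t powr (- 5 / 2) = t powr (- 3 / 2)"
    using powr_add[of t 1 "- 5 / 2"] by simp
  then show ?thesis using False by (simp add: newton_profile_def max_def)
qed

text \<open>
  Outside the ball of radius \<open>a\<close> the regularisation at scale \<open>a\<close> is independent of \<open>a\<close>, so two of them
  cancel outside the larger ball.
\<close>
lemma newton_profile_scaled: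
  assumes "0 < a" "a\<^sup>2 \<le> s"
  shows "newton_profile (s / a\<^sup>2) / a ^ 3 = s powr (- 3 / 2)"
proof -
  have s: "0 < s" using assms by (metis less_le_trans zero_less_power)
  have "(a\<^sup>2) powr (- 3 / 2) = 1 / a ^ 3"
    using assms by (simp add: powr_powr powr_numeral[symmetric] powr_minus_divide del: powr_numeral)
  then show ?thesis using assms s by (simp add: newton_profile_def powr_divide)
qed

lemma newton_profile_bounds:
  assumes "0 < a" "0 < s"
  shows "0 \<le> newton_profile (s / a\<^sup>2) / a ^ 3" "newton_profile (s / a\<^sup>2) / a ^ 3 \<le> 5 / 2 * s powr (- 3 / 2)"
proof -
  show "0 \<le> newton_profile (s / a\<^sup>2) / a ^ 3"
    using assms by (auto simp: newton_profile_def field_simps)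
  show "newton_profile (s / a\<^sup>2) / a ^ 3 \<le> 5 / 2 * s powr (- 3 / 2)"
  proof (cases "a\<^sup>2 \<le> s")
    case True
    then show ?thesis using newton_profile_scaled[OF assms(1) True] by simp
  next
    case False
    have "newton_profile (s / a\<^sup>2) / a ^ 3 \<le> (5 / 2) / a ^ 3"
      using False assms by (intro divide_right_mono) (auto simp: newton_profile_def)
    also have "(5 / 2) / a ^ 3 = 5 / 2 * (a\<^sup>2) powr (- 3 / 2)"
      using assms by (simp add: powr_powr powr_numeral[symmetric] powr_minus_divide del: powr_numeral)
    also have "\<dots> \<le> 5 / 2 * s powr (- 3 / 2)"
      using False assms by (intro mult_left_mono powr_mono2') auto
    finally show ?thesis .
  qed
qed

section \<open>The Biot-Savart bound\<close>

lemma smooth_jacobian: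
  assumes "smooth u"
  shows "continuous_on UNIV u"
    and "continuous_on UNIV (\<lambda>y. jacobian u (at y) $ a $ k)"
    and "((\<lambda>t. u (y + t *\<^sub>R axis k 1) $ a) has_real_derivative jacobian u (at y) $ a $ k) (at 0)"
proof -
  have C: "C_k 1 u" using assms by (simp add: smooth_def)
  then have d: "u differentiable at y" for y
    by (simp add: differentiable_on_def)
  show "continuous_on UNIV u" using C by (simp add: differentiable_imp_continuous_on)
  have Jeq: "jacobian u (at y) $ a $ k = frechet_derivative u (at y) (axis k 1) $ a" for y
    by (simp add: jacobian_def matrix_def)
  have "continuous_on UNIV (\<lambda>y. frechet_derivative u (at y) (axis k 1))"
    using C by simp
  then show "continuous_on UNIV (\<lambda>y. jacobian u (at y) $ a $ k)"
    unfolding Jeq by (intro continuous_intros)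
  have "(u has_derivative frechet_derivative u (at y)) (at (y + 0 *\<^sub>R axis k 1))"
    using d frechet_derivative_works by auto
  moreover have "((\<lambda>t. y + t *\<^sub>R axis k 1) has_derivative (\<lambda>t. t *\<^sub>R axis k 1)) (at 0)"
    by (auto intro!: derivative_eq_intros)
  ultimately have "((\<lambda>t. u (y + t *\<^sub>R axis k 1)) has_derivative (\<lambda>t. frechet_derivative u (at y) (t *\<^sub>R axis k 1))) (at 0)"
    using has_derivative_compose by blast
  then have "((\<lambda>t. u (y + t *\<^sub>R axis k 1) $ a) has_derivative (\<lambda>t. frechet_derivative u (at y) (t *\<^sub>R axis k 1) $ a)) (at 0)"
    by (rule bounded_linear.has_derivative[OF bounded_linear_vec_nth])
  moreover have "(\<lambda>t. frechet_derivative u (at y) (t *\<^sub>R axis k 1) $ a) = (*) (jacobian u (at y) $ a $ k)"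
    using linear_frechet_derivative[OF d[of y]] by (auto simp: Jeq linear_cmul)
  ultimately show "((\<lambda>t. u (y + t *\<^sub>R axis k 1) $ a) has_real_derivative jacobian u (at y) $ a $ k) (at 0)"
    by (simp add: has_field_derivative_def)
qed

lemma abs_jacobian_skew_le_norm_curl:
  "\<bar>jacobian u (at y) $ j $ i - jacobian u (at y) $ i $ j\<bar> \<le> norm (curl u y)"
proof -
  have "\<bar>curl u y $ k\<bar> \<le> norm (curl u y)" for k by (rule component_le_norm_cart)
  from this[of 1] this[of 2] this[of 3] show ?thesis
    using exhaust_3[of i] exhaust_3[of j] by (auto simp: curl_def Let_def)
qed

lemma continuous_on_curl:
  assumes "smooth u"
  shows "continuous_on UNIV (curl u)"
proof -
  have "continuous_on UNIV (\<lambda>y. curl u y $ k)" for k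
    using exhaust_3[of k] unfolding curl_def Let_def
    by (auto intro!: continuous_on_diff smooth_jacobian(2)[OF assms])
  then have "continuous_on UNIV (\<lambda>y. \<chi> k. curl u y $ k)" by (rule continuous_on_vec_lambda)
  then show ?thesis by simp
qed

text \<open>
  The radial flux identity is applied to the difference of the regularised Newtonian fields at scales
  \<open>\<epsilon> \<le> \<rho>\<close> centred at \<open>x\<close>, whose divergence is \<open>m \<epsilon> - m \<rho>\<close>.  The vorticity integral is bounded
  independently of both scales (\<open>flux\<close>), the mean of \<open>u\<close> against \<open>m \<rho>\<close> is at most a multiple of the mean
  of \<open>|u|\<close> over a ball of radius \<open>2 \<rho>\<close> about the origin (\<open>far\<close>), and the mean against \<open>m \<epsilon>\<close>
  recovers \<open>u x $ i\<close> by continuity (\<open>near\<close>).  The mass of \<open>m \<epsilon>\<close> is at least \<open>1\<close> at every scale, so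
  \<open>u x $ i\<close> is not lost in the limit.  The constant \<open>15 / 2\<close> is the product of the bound \<open>5 / 2\<close> of the profile and the
  number \<open>3\<close> of components.
\<close>
lemma abs_component_le_vorticity_potential:
  assumes smooth: "smooth u" and div: "\<And>y. divergence u y = 0"
    and vanish: "vanishes_at_infinity_in_mean u"
  shows "ennreal \<bar>u x $ i\<bar> \<le> ennreal (15 / 2) * (\<integral>\<^sup>+y. ennreal (norm (curl u y) / (norm (y - x))\<^sup>2) \<partial>lborel)"
proof (cases "(\<integral>\<^sup>+y. ennreal (norm (curl u y) / (norm (y - x))\<^sup>2) \<partial>lborel) = \<infinity>")
  case True
  then show ?thesis by (simp add: ennreal_mult_top)
next
  case False
  note contu = smooth_jacobian(1)[OF smooth] and contJ = smooth_jacobian(2)[OF smooth]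
    and derJ = smooth_jacobian(3)[OF smooth]
  have contcurl: "continuous_on UNIV (curl u)" using smooth by (rule continuous_on_curl)
  have [measurable]: "curl u \<in> borel_measurable borel" using contcurl by (rule borel_measurable_continuous_onI)
  define \<sigma> where "\<sigma> = (\<lambda>y. (y - x) \<bullet> (y - x))"
  define I where "I = (\<integral>y. norm (curl u y) / (norm (y - x))\<^sup>2 \<partial>lborel)"
  have intI: "integrable lborel (\<lambda>y. norm (curl u y) / (norm (y - x))\<^sup>2)"
    using False by (intro integrableI_nonneg) (auto simp: less_top)
  have I: "(\<integral>\<^sup>+y. ennreal (norm (curl u y) / (norm (y - x))\<^sup>2) \<partial>lborel) = ennreal I"
    unfolding I_def by (intro nn_integral_eq_integral intI) auto
  have cont\<sigma>: "continuous_on UNIV \<sigma>" unfolding \<sigma>_def by (intro continuous_intros)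
  have \<sigma>norm: "\<sigma> y = (norm (y - x))\<^sup>2" for y by (simp add: \<sigma>_def dot_square_norm)
  define m where "m = (\<lambda>a y. 15 / 2 / a ^ 3 * max 0 (1 - \<sigma> y / a\<^sup>2))"
  have m0: "0 \<le> m a y" if "0 < a" for a y using that by (simp add: m_def)
  have msupp: "m a y = 0" if "0 < a" "a \<le> norm (y - x)" for a y
  proof -
    have "a\<^sup>2 \<le> \<sigma> y" using that by (simp add: \<sigma>norm power_mono)
    then show ?thesis using that by (simp add: m_def)
  qed
  have contm: "continuous_on UNIV (m a)" if "0 < a" for a
    unfolding m_def by (intro continuous_intros cont\<sigma>) (use that in auto)
  have intm: "integrable lborel (\<lambda>y. f y * m a y)" if "continuous_on UNIV f" "0 < a" for f a
  proof (rule integrable_continuous_compact_support[where B = "norm x + a"])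
    show "f y * m a y = 0" if "norm x + a < norm y" for y
    proof -
      have "a \<le> norm (y - x)" using that norm_triangle_ineq2[of y x] by linarith
      then show ?thesis using msupp[OF \<open>0 < a\<close>] by simp
    qed
  qed (intro continuous_intros that contm)
  have flux: "\<bar>(\<integral>y. u y $ i * m \<epsilon> y \<partial>lborel) - (\<integral>y. u y $ i * m \<rho> y \<partial>lborel)\<bar> \<le> 15 / 2 * I"
    if \<epsilon>: "0 < \<epsilon>" and \<rho>: "\<epsilon> \<le> \<rho>" for \<epsilon> \<rho>
  proof -
    have \<rho>0: "0 < \<rho>" using \<epsilon> \<rho> by simp
    define L where "L = (\<lambda>a s. newton_profile (s / a\<^sup>2) / a ^ 3)"
    define L' :: "real \<Rightarrow> real \<Rightarrow> real" where "L' = (\<lambda>a s. - (3 / 2) * max (s / a\<^sup>2) 1 powr (- 5 / 2) / a\<^sup>2 / a ^ 3)"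
    have derL: "(L a has_real_derivative L' a s) (at s)" if "0 < a" for a s
    proof -
      have 1: "((\<lambda>s. s / a\<^sup>2) has_real_derivative 1 / a\<^sup>2) (at s)"
        by (rule DERIV_cdivide[OF DERIV_ident])
      show ?thesis unfolding L_def L'_def
        by (rule DERIV_cong[OF DERIV_cdivide[OF DERIV_chain2[OF DERIV_newton_profile 1]]]) simp
    qed
    have contL': "continuous_on UNIV (L' a)" if "0 < a" for a
      
    proof -
      have nz: "a\<^sup>2 \<noteq> 0" "a ^ 3 \<noteq> 0" using that by auto
      have "max (s / a\<^sup>2) 1 \<noteq> 0" for s :: real by (auto simp: max_def)
      with nz show ?thesis unfolding L'_def by (intro continuous_intros ballI) auto
    qed
    have mL: "2 * \<sigma> y * L' a (\<sigma> y) + 3 * L a (\<sigma> y) = m a y" if "0 < a" for a y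
    proof -
      have "2 * \<sigma> y * L' a (\<sigma> y) + 3 * L a (\<sigma> y)
          = (3 * newton_profile (\<sigma> y / a\<^sup>2) + 2 * (\<sigma> y / a\<^sup>2) * (- (3 / 2) * max (\<sigma> y / a\<^sup>2) 1 powr (- 5 / 2))) / a ^ 3"
        by (simp add: L_def L'_def add_divide_distrib diff_divide_distrib)
      also have "\<dots> = m a y" unfolding newton_profile_divergence by (simp add: m_def)
      finally show ?thesis .
    qed
    define G where "G = (\<lambda>s. L \<epsilon> s - L \<rho> s)"
    define G' where "G' = (\<lambda>s. L' \<epsilon> s - L' \<rho> s)"
    have Gbound: "\<bar>G s\<bar> \<le> 5 / 2 * s powr (- 3 / 2)" if "0 < s" for s
      using newton_profile_bounds[OF \<epsilon> that] newton_profile_bounds[OF \<rho>0 that]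
      unfolding G_def L_def by linarith
    have eq: "(\<integral>y. u y $ i * (2 * \<sigma> y * G' (\<sigma> y) + real CARD(3) * G (\<sigma> y)) \<partial>lborel)
      = (\<integral>y. G (\<sigma> y) * (\<Sum>j\<in>UNIV. (jacobian u (at y) $ j $ i - jacobian u (at y) $ i $ j) * (y - x) $ j) \<partial>lborel)"
      unfolding \<sigma>_def
    proof (rule radial_flux_identity[where B = \<rho>])
      show "(G has_real_derivative G' s) (at s)" for s
        unfolding G_def G'_def using \<epsilon> \<rho>0 by (intro DERIV_diff derL)
      show "continuous_on UNIV G'"
        unfolding G'_def using \<epsilon> \<rho>0 by (intro continuous_intros contL')
      show "G s = 0" if "\<rho>\<^sup>2 \<le> s" for s
      proof -
        have "\<epsilon>\<^sup>2 \<le> s" using that \<epsilon> \<rho> power_mono[of \<epsilon> \<rho> 2] by linarith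
        then show ?thesis using that \<epsilon> \<rho>0 by (simp add: G_def L_def newton_profile_scaled)
      qed
    qed (use contu contJ derJ div \<rho>0 in \<open>auto simp: divergence_def\<close>)
    have "2 * \<sigma> y * G' (\<sigma> y) + real CARD(3) * G (\<sigma> y) = m \<epsilon> y - m \<rho> y" for y
      using mL[OF \<epsilon>, of y] mL[OF \<rho>0, of y] by (simp add: G_def G'_def algebra_simps)
    with eq have "(\<integral>y. u y $ i * m \<epsilon> y \<partial>lborel) - (\<integral>y. u y $ i * m \<rho> y \<partial>lborel)
      = (\<integral>y. G (\<sigma> y) * (\<Sum>j\<in>UNIV. (jacobian u (at y) $ j $ i - jacobian u (at y) $ i $ j) * (y - x) $ j) \<partial>lborel)"
      using \<epsilon> \<rho>0 contu by (simp add: right_diff_distrib intm continuous_on_component)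
    also have "\<bar>\<dots>\<bar> \<le> (\<integral>y. 15 / 2 * (norm (curl u y) / (norm (y - x))\<^sup>2) \<partial>lborel)"
    proof (rule order_trans[OF integral_abs_bound integral_mono_AE'])
      show "AE y in lborel. \<bar>G (\<sigma> y) * (\<Sum>j\<in>UNIV. (jacobian u (at y) $ j $ i - jacobian u (at y) $ i $ j) * (y - x) $ j)\<bar>
          \<le> 15 / 2 * (norm (curl u y) / (norm (y - x))\<^sup>2)"
      proof (intro always_eventually allI)
        fix y
        show "\<bar>G (\<sigma> y) * (\<Sum>j\<in>UNIV. (jacobian u (at y) $ j $ i - jacobian u (at y) $ i $ j) * (y - x) $ j)\<bar>
          \<le> 15 / 2 * (norm (curl u y) / (norm (y - x))\<^sup>2)"
        proof (cases "y = x")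
          case False
          then have n: "0 < norm (y - x)" by simp
          have "\<bar>\<Sum>j\<in>UNIV. (jacobian u (at y) $ j $ i - jacobian u (at y) $ i $ j) * (y - x) $ j\<bar>
              \<le> (\<Sum>j\<in>(UNIV::3 set). norm (curl u y) * norm (y - x))"
            unfolding abs_mult[symmetric]
            by (intro order_trans[OF sum_abs] sum_mono, unfold abs_mult)
               (intro mult_mono abs_jacobian_skew_le_norm_curl component_le_norm_cart, auto)
          then have "\<bar>G (\<sigma> y) * (\<Sum>j\<in>UNIV. (jacobian u (at y) $ j $ i - jacobian u (at y) $ i $ j) * (y - x) $ j)\<bar>
             \<le> (5 / 2 * \<sigma> y powr (- 3 / 2)) * (3 * (norm (curl u y) * norm (y - x)))"
            unfolding abs_mult using n by (intro mult_mono Gbound) (auto simp: \<sigma>norm)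
          also have "\<sigma> y powr (- 3 / 2) = 1 / (norm (y - x)) ^ 3"
            using n by (simp add: \<sigma>norm powr_powr powr_numeral[symmetric] powr_minus_divide del: powr_numeral)
          finally show ?thesis using n by (simp add: power2_eq_square power3_eq_cube)
        qed simp
      qed
    qed (rule integrable_mult_right[OF intI] AE_I2 | simp)+
    also have "\<dots> = 15 / 2 * I" unfolding I_def by (rule integral_mult_right_zero)
    finally show ?thesis .
  qed
  define avg where "avg = (\<lambda>\<rho>. (LINT x:ball 0 \<rho>|lborel. norm (u x)) / measure lborel (ball (0::real^3) \<rho>))"
  have avg0: "(avg \<longlongrightarrow> 0) at_top" using vanish by (simp add: vanishes_at_infinity_in_mean_def avg_def)
  have vol: "measure lborel (ball z r) = 4 / 3 * pi * r ^ 3" if "0 \<le> r" for z :: "real^3" and r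
    using content_ball[OF that, of z] by (simp add: unit_ball_vol_3)
  have far: "\<bar>\<integral>y. u y $ i * m \<rho> y \<partial>lborel\<bar> \<le> 80 * pi * avg (2 * \<rho>)" if \<rho>: "0 < \<rho>" "norm x \<le> \<rho>" for \<rho>
  proof -
    have "\<bar>\<integral>y. u y $ i * m \<rho> y \<partial>lborel\<bar> \<le> (\<integral>y. 15 / 2 / \<rho> ^ 3 * (indicator (ball 0 (2 * \<rho>)) y *\<^sub>R norm (u y)) \<partial>lborel)"
    proof (rule order_trans[OF integral_abs_bound integral_mono_AE'])
      have "integrable lborel (\<lambda>y. indicator (ball 0 (2 * \<rho>)) y *\<^sub>R norm (u y))"
      proof -
        have "set_integrable lborel (cball 0 (2 * \<rho>)) (\<lambda>y. norm (u y))"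
          unfolding set_integrable_def
          by (intro borel_integrable_compact continuous_intros continuous_on_subset[OF contu]) auto
        then have "set_integrable lborel (ball 0 (2 * \<rho>)) (\<lambda>y. norm (u y))"
          by (rule set_integrable_subset) auto
        then show ?thesis by (simp add: set_integrable_def)
      qed
      then show "integrable lborel (\<lambda>y. 15 / 2 / \<rho> ^ 3 * (indicator (ball 0 (2 * \<rho>)) y *\<^sub>R norm (u y)))"
        by (rule integrable_mult_right)
      show "AE y in lborel. \<bar>u y $ i * m \<rho> y\<bar> \<le> 15 / 2 / \<rho> ^ 3 * (indicator (ball 0 (2 * \<rho>)) y *\<^sub>R norm (u y))"
      proof (intro always_eventually allI)
        fix y
        show "\<bar>u y $ i * m \<rho> y\<bar> \<le> 15 / 2 / \<rho> ^ 3 * (indicator (ball 0 (2 * \<rho>)) y *\<^sub>R norm (u y))"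
        proof (cases "y \<in> ball 0 (2 * \<rho>)")
          case True
          have "m \<rho> y \<le> 15 / 2 / \<rho> ^ 3 * 1"
            unfolding m_def using \<rho> by (intro mult_left_mono) (auto simp: \<sigma>norm)
          then have "\<bar>u y $ i\<bar> * m \<rho> y \<le> norm (u y) * (15 / 2 / \<rho> ^ 3 * 1)"
            using m0[OF \<rho>(1)] by (intro mult_mono component_le_norm_cart) auto
          then show ?thesis using True m0[OF \<rho>(1), of y] by (simp add: abs_mult mult.commute)
        next
          case False
          then have "\<rho> \<le> norm (y - x)" using \<rho> norm_triangle_ineq2[of y x] by auto
          then show ?thesis using msupp[OF \<rho>(1)] \<rho> by simp
        qed
      qed
    qed (use \<rho> in auto)
    also have "\<dots> = 15 / 2 / \<rho> ^ 3 * (avg (2 * \<rho>) * (4 / 3 * pi * (2 * \<rho>) ^ 3))"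
      using \<rho> by (simp add: avg_def vol set_lebesgue_integral_def)
    also have "\<dots> = 80 * pi * avg (2 * \<rho>)" using \<rho> by (simp add: power_mult_distrib)
    finally show ?thesis .
  qed
  have near: "\<bar>u x $ i\<bar> - \<eta> \<le> \<bar>\<integral>y. u y $ i * m \<epsilon> y \<partial>lborel\<bar>"
    if \<epsilon>: "0 < \<epsilon>" and \<eta>: "\<And>y. norm (y - x) < \<epsilon> \<Longrightarrow> \<bar>u y $ i - u x $ i\<bar> \<le> \<eta>" for \<epsilon> \<eta>
  proof (cases "\<eta> \<le> \<bar>u x $ i\<bar>")
    case True
    define c where "c = (\<integral>y. m \<epsilon> y \<partial>lborel)"
    have intm1: "integrable lborel (m \<epsilon>)" using intm[of "\<lambda>_. 1" \<epsilon>] \<epsilon> by simp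
    \<comment> \<open>On the ball of half the radius the bump is at least three quarters of its maximum.\<close>
    have "1 \<le> 45 / 8 / \<epsilon> ^ 3 * (4 / 3 * pi * (\<epsilon> / 2) ^ 3)"
      using \<epsilon> pi_gt3 by (simp add: power_divide)
    also have "\<dots> = (\<integral>y. 45 / 8 / \<epsilon> ^ 3 * indicator (ball x (\<epsilon> / 2)) y \<partial>lborel)"
      using \<epsilon> by (simp add: vol)
    also have "\<dots> \<le> c" unfolding c_def
    proof (rule integral_mono[OF _ intm1])
      show "integrable lborel (\<lambda>y. 45 / 8 / \<epsilon> ^ 3 * indicator (ball x (\<epsilon> / 2)) y :: real)"
        by (intro integrable_mult_right) (auto intro!: integrable_real_indicator emeasure_lborel_ball_finite)
      fix y
      show "45 / 8 / \<epsilon> ^ 3 * indicator (ball x (\<epsilon> / 2)) y \<le> m \<epsilon> y"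
      proof (cases "y \<in> ball x (\<epsilon> / 2)")
        case True
        then have "\<sigma> y \<le> (\<epsilon> / 2)\<^sup>2"
          unfolding \<sigma>norm by (intro power_mono) (auto simp: dist_norm norm_minus_commute)
        then have "\<sigma> y / \<epsilon>\<^sup>2 \<le> 1 / 4" using \<epsilon> by (simp add: field_simps power_divide)
        then have "3 / 4 \<le> max 0 (1 - \<sigma> y / \<epsilon>\<^sup>2)" by linarith
        then have "15 / 2 / \<epsilon> ^ 3 * (3 / 4) \<le> m \<epsilon> y"
          unfolding m_def using \<epsilon> by (intro mult_left_mono) auto
        then show ?thesis using True by simp
      qed (use m0 \<epsilon> in auto)
    qed
    finally have c: "1 \<le> c" .
    have "\<bar>(\<integral>y. u y $ i * m \<epsilon> y \<partial>lborel) - u x $ i * c\<bar> = \<bar>\<integral>y. (u y $ i - u x $ i) * m \<epsilon> y \<partial>lborel\<bar>"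
      using intm1 intm[OF continuous_on_component[OF contu] \<epsilon>]
      by (simp add: c_def left_diff_distrib)
    also have "\<dots> \<le> (\<integral>y. \<eta> * m \<epsilon> y \<partial>lborel)"
    proof (rule order_trans[OF integral_abs_bound integral_mono_AE'])
      show "AE y in lborel. \<bar>(u y $ i - u x $ i) * m \<epsilon> y\<bar> \<le> \<eta> * m \<epsilon> y"
      proof (intro always_eventually allI)
        fix y
        show "\<bar>(u y $ i - u x $ i) * m \<epsilon> y\<bar> \<le> \<eta> * m \<epsilon> y"
          using \<eta>[of y] msupp[OF \<epsilon>, of y] m0[OF \<epsilon>, of y]
          by (cases "norm (y - x) < \<epsilon>") (auto simp: abs_mult intro: mult_right_mono)
      qed
    qed (use intm1 \<eta>[of x] m0 \<epsilon> in auto)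
    also have "\<dots> = \<eta> * c" by (simp add: c_def)
    finally have "\<bar>u x $ i\<bar> * c - \<eta> * c \<le> \<bar>\<integral>y. u y $ i * m \<epsilon> y \<partial>lborel\<bar>"
      using c abs_mult[of "u x $ i" c] by linarith
    moreover have "(\<bar>u x $ i\<bar> - \<eta>) * 1 \<le> (\<bar>u x $ i\<bar> - \<eta>) * c"
      using True c by (intro mult_left_mono) auto
    ultimately show ?thesis by (simp add: left_diff_distrib)
  qed simp
  have "\<bar>u x $ i\<bar> \<le> 15 / 2 * I + \<eta>" if "0 < \<eta>" for \<eta>
  proof -
    have "continuous (at x) (\<lambda>y. u y $ i)"
      using continuous_on_component[OF contu] by (simp add: continuous_on_eq_continuous_at)
    then obtain \<epsilon> where \<epsilon>: "0 < \<epsilon>" "\<And>y. norm (y - x) < \<epsilon> \<Longrightarrow> \<bar>u y $ i - u x $ i\<bar> \<le> \<eta>"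
      using \<open>0 < \<eta>\<close> unfolding continuous_at_eps_delta dist_norm real_norm_def by (meson less_imp_le)
    have ev: "\<forall>\<^sub>F \<rho> in at_top. \<bar>u x $ i\<bar> \<le> 15 / 2 * I + \<eta> + 80 * pi * avg (2 * \<rho>)"
      using eventually_ge_at_top[of "max \<epsilon> (norm x)"]
    proof eventually_elim
      case (elim \<rho>)
      then have \<rho>: "\<epsilon> \<le> \<rho>" "norm x \<le> \<rho>" "0 < \<rho>" using \<epsilon>(1) by auto
      show ?case using near[OF \<epsilon>] far[OF \<rho>(3,2)] flux[OF \<epsilon>(1) \<rho>(1)] by linarith
    qed
    have "((\<lambda>\<rho>. avg (2 * \<rho>)) \<longlongrightarrow> 0) at_top"
      by (rule filterlim_compose[OF avg0]) (intro filterlim_tendsto_pos_mult_at_top[OF tendsto_const] filterlim_ident, simp)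
    then have "((\<lambda>\<rho>. 15 / 2 * I + \<eta> + 80 * pi * avg (2 * \<rho>)) \<longlongrightarrow> 15 / 2 * I + \<eta> + 80 * pi * 0) at_top"
      by (intro tendsto_intros)
    then show ?thesis using tendsto_lowerbound[OF _ ev] by simp
  qed
  then have "\<bar>u x $ i\<bar> \<le> 15 / 2 * I" by (rule field_le_epsilon)
  moreover have "0 \<le> I" unfolding I_def by simp
  ultimately show ?thesis unfolding I by (simp add: ennreal_mult[symmetric] ennreal_leI)
qed

section \<open>Rotations about the axis and meridional distance\<close>

lemma distr_lborel_orthogonal:
  fixes f :: "real^'n::{finite,wellorder} \<Rightarrow> real^'n::_"
  assumes f: "orthogonal_transformation f"
  shows "distr lborel borel f = lborel"
proof (rule lborel_eqI[symmetric])
  obtain g where g: "orthogonal_transformation g" "\<And>x. f (g x) = x" "\<And>x. g (f x) = x"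
    using f orthogonal_transformation_inv orthogonal_transformation_bij[OF f]
    by (metis bij_inv_eq_iff)
  have [measurable]: "f \<in> borel_measurable borel"
    using f by (intro borel_measurable_continuous_onI linear_continuous_on)
      (auto intro: linear_linear[THEN iffD2] orthogonal_transformation_linear simp: linear_conv_bounded_linear[symmetric])
  fix l u :: "(real, 'n) vec" assume le: "\<And>b. b \<in> Basis \<Longrightarrow> l \<bullet> b \<le> u \<bullet> b"
  have vim: "f -` box l u = g ` box l u" using g by (auto simp: image_iff) metis
  have borel: "f -` box l u \<in> sets borel"
    using measurable_sets[of f borel borel "box l u"] by simp
  have "emeasure (distr lborel borel f) (box l u) = emeasure lborel (f -` box l u)"
    by (simp add: emeasure_distr)
  also have "\<dots> = emeasure lebesgue (g ` box l u)" using borel by (simp add: vim)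
  also have "\<dots> = ennreal (measure lebesgue (g ` box l u))"
    by (intro emeasure_eq_measure2 measurable_orthogonal_image g) auto
  also have "\<dots> = ennreal (measure lebesgue (box l u))"
    by (subst measure_orthogonal_image[OF g(1)]) auto
  also have "\<dots> = (\<Prod>b\<in>Basis. (u - l) \<bullet> b)" using le by (simp add: measure_lborel_box_eq inner_diff_left)
  finally show "emeasure (distr lborel borel f) (box l u) = (\<Prod>b\<in>Basis. (u - l) \<bullet> b)" .
qed simp

definition axis_rotation :: "real \<Rightarrow> real^3 \<Rightarrow> real^3" where
  "axis_rotation \<phi> y = vector [cos \<phi> * y$1 - sin \<phi> * y$2, sin \<phi> * y$1 + cos \<phi> * y$2, y$3]"

lemma orthogonal_axis_rotation: "orthogonal_transformation (axis_rotation \<phi>)"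
  unfolding orthogonal_transformation
proof (intro conjI allI)
  show "linear (axis_rotation \<phi>)"
    by (rule linearI) (auto simp: axis_rotation_def vec_eq_iff forall_3 algebra_simps)
  fix v :: "real^3"
  have "(cos \<phi> * v$1 - sin \<phi> * v$2)\<^sup>2 + (sin \<phi> * v$1 + cos \<phi> * v$2)\<^sup>2
      = ((sin \<phi>)\<^sup>2 + (cos \<phi>)\<^sup>2) * ((v$1)\<^sup>2 + (v$2)\<^sup>2)"
    by (simp add: power2_eq_square algebra_simps del: sin_cos_squared_add sin_cos_squared_add2 sin_cos_squared_add3)
  then show "norm (axis_rotation \<phi> v) = norm v"
    by (simp add: norm_vec_def L2_set_def sum_3 axis_rotation_def)
qed

lemma cyl_radius_cyl_point:
  assumes "0 \<le> r"
  shows "cyl_radius (cyl_point r \<theta> z) = r"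
proof -
  have "(r * cos \<theta>)\<^sup>2 + (r * sin \<theta>)\<^sup>2 = r\<^sup>2 * ((sin \<theta>)\<^sup>2 + (cos \<theta>)\<^sup>2)"
    by (simp add: power_mult_distrib algebra_simps del: sin_cos_squared_add sin_cos_squared_add2)
  then show ?thesis using assms by (simp add: cyl_radius_def cyl_point_def)
qed

lemma obtain_cyl_point:
  obtains \<theta> where "x = cyl_point (cyl_radius x) \<theta> (x $ 3)"
proof (cases "cyl_radius x = 0")
  case True
  then have "x $ 1 = 0" "x $ 2 = 0" by (auto simp: cyl_radius_def sum_power2_eq_zero_iff)
  then show ?thesis using True by (intro that[of 0]) (simp add: cyl_point_def vec_eq_iff forall_3)
next
  case False
  then have "0 < cyl_radius x" by (simp add: cyl_radius_def less_le)
  have sq: "(cyl_radius x)\<^sup>2 = (x$1)\<^sup>2 + (x$2)\<^sup>2" by (simp add: cyl_radius_def)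
  then have "(x$1 / cyl_radius x)\<^sup>2 + (x$2 / cyl_radius x)\<^sup>2 = 1"
    using False unfolding power_divide add_divide_distrib[symmetric] sq[symmetric] by simp
  then obtain t where "x$1 / cyl_radius x = cos t" "x$2 / cyl_radius x = sin t"
    by (rule sincos_total_2pi)
  then show ?thesis using False by (intro that[of t]) (simp add: cyl_point_def vec_eq_iff forall_3 field_simps)
qed

lemma axis_rotation_cyl_point: "axis_rotation \<phi> (cyl_point r \<theta> z) = cyl_point r (\<phi> + \<theta>) z"
  by (simp add: axis_rotation_def cyl_point_def vec_eq_iff forall_3 cos_add sin_add algebra_simps)

lemma cyl_radius_nonneg [simp]: "0 \<le> cyl_radius x"
  by (simp add: cyl_radius_def)

lemma cyl_radius_axis_rotation [simp]: "cyl_radius (axis_rotation \<phi> y) = cyl_radius y"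
  by (metis obtain_cyl_point axis_rotation_cyl_point cyl_radius_cyl_point cyl_radius_nonneg)

lemma axis_rotation_3 [simp]: "axis_rotation \<phi> y $ 3 = y $ 3"
  by (simp add: axis_rotation_def)

lemma norm_cyl_point_diff:
  "(norm (cyl_point r' \<alpha> z' - cyl_point r \<theta> z))\<^sup>2 = (r - r')\<^sup>2 + (z - z')\<^sup>2 + 2 * r * r' * (1 - cos (\<alpha> - \<theta>))"
proof -
  have "(norm (cyl_point r' \<alpha> z' - cyl_point r \<theta> z))\<^sup>2
     = (r' * cos \<alpha> - r * cos \<theta>)\<^sup>2 + (r' * sin \<alpha> - r * sin \<theta>)\<^sup>2 + (z' - z)\<^sup>2"
    by (simp add: norm_vec_def L2_set_def sum_3 cyl_point_def)
  also have "\<dots> = r'\<^sup>2 * ((sin \<alpha>)\<^sup>2 + (cos \<alpha>)\<^sup>2) + r\<^sup>2 * ((sin \<theta>)\<^sup>2 + (cos \<theta>)\<^sup>2)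
      - 2 * r * r' * (cos \<alpha> * cos \<theta> + sin \<alpha> * sin \<theta>) + (z' - z)\<^sup>2"
    by (simp add: power2_eq_square algebra_simps del: sin_cos_squared_add sin_cos_squared_add2 sin_cos_squared_add3)
  also have "\<dots> = (r - r')\<^sup>2 + (z - z')\<^sup>2 + 2 * r * r' * (1 - cos (\<alpha> - \<theta>))"
    by (simp add: cos_diff power2_eq_square algebra_simps)
  finally show ?thesis .
qed

definition meridional_dist :: "real^3 \<Rightarrow> real^3 \<Rightarrow> real" where
  "meridional_dist x y = sqrt ((cyl_radius x - cyl_radius y)\<^sup>2 + (x$3 - y$3)\<^sup>2)"

lemma meridional_dist_nonneg [simp]: "0 \<le> meridional_dist x y"
  by (simp add: meridional_dist_def)

lemma meridional_dist_commute: "meridional_dist x y = meridional_dist y x"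
  by (simp add: meridional_dist_def power2_commute)

lemma continuous_on_cyl_radius [continuous_intros]:
  "continuous_on S f \<Longrightarrow> continuous_on S (\<lambda>x. cyl_radius (f x))"
  unfolding cyl_radius_def by (intro continuous_intros)

lemma continuous_on_meridional_dist [continuous_intros]:
  "continuous_on S f \<Longrightarrow> continuous_on S g \<Longrightarrow> continuous_on S (\<lambda>x. meridional_dist (f x) (g x))"
  unfolding meridional_dist_def by (intro continuous_intros)

section \<open>Averaging the kernel over rotations\<close>

text \<open>
  This is \<open>sin y \<ge> y / 2\<close> on \<open>[0, \<pi>/2]\<close> after halving the angle; the latter follows from
  \<open>tan y \<ge> y\<close> and one more halving, which keeps the cosine away from zero.
\<close>
lemma one_minus_cos_ge:
  assumes "\<bar>\<psi>\<bar> \<le> pi"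
  shows "\<psi>\<^sup>2 / 8 \<le> 1 - cos \<psi>"
proof -
  define y where "y = \<bar>\<psi>\<bar> / 4"
  have y: "0 \<le> y" "y \<le> pi / 4" using assms by (auto simp: y_def)
  then have y2: "y < pi / 2" using pi_gt_zero by linarith
  have c: "0 < cos y" using y y2 by (intro cos_gt_zero_pi) auto
  have "0 \<le> cos (2 * y)" using y by (intro cos_ge_zero) auto
  then have c2: "1 / 2 \<le> (cos y)\<^sup>2" by (simp add: cos_double_cos)
  have "y \<le> tan y" using abs_tan_ge[of y] y y2 tan_pos_pi2_le[of y] by auto
  then have "y * cos y \<le> sin y" using c by (simp add: tan_def field_simps)
  then have "y * cos y * cos y \<le> sin y * cos y" using c by (intro mult_right_mono) auto
  moreover have "y * (1 / 2) \<le> y * (cos y)\<^sup>2" using y c2 by (intro mult_left_mono) auto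
  ultimately have "y \<le> sin (2 * y)" by (simp add: sin_double power2_eq_square mult.assoc)
  then have "y\<^sup>2 \<le> (sin (2 * y))\<^sup>2" using y by (intro power_mono) auto
  moreover have "1 - cos (2 * (2 * y)) = 2 * (sin (2 * y))\<^sup>2" using cos_double_sin[of "2 * y"] by linarith
  moreover have "cos (2 * (2 * y)) = cos \<psi>" by (simp add: y_def)
  moreover have "y\<^sup>2 = \<psi>\<^sup>2 / 16" by (simp add: y_def power_divide)
  ultimately show ?thesis by linarith
qed

text \<open>
  If \<open>r' \<le> 2 r\<close>, the denominator is at least \<open>\<rho>\<^sup>2 + a\<^sup>2 \<psi>\<^sup>2\<close> with \<open>a = r' / 3\<close>, and the integral is an
  arctangent.  Otherwise \<open>r' \<le> 2 \<rho>\<close> because \<open>\<bar>r - r'\<bar> \<le> \<rho>\<close>, and bounding the denominator below by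
  \<open>\<rho>\<^sup>2\<close> suffices.
\<close>
lemma angular_integral_bound:
  assumes r: "0 \<le> r" "0 \<le> r'" and \<rho>: "0 < \<rho>" "\<bar>r - r'\<bar> \<le> \<rho>"
  shows "(\<integral>\<^sup>+\<psi>\<in>{-pi..pi}. ennreal (r' / (\<rho>\<^sup>2 + 2 * r * r' * (1 - cos \<psi>))) \<partial>lborel) \<le> ennreal (4 * pi / \<rho>)"
proof (cases "r' \<le> 2 * r \<and> 0 < r'")
  case True
  define a where "a = r' / 3"
  have a: "0 < a" using True by (simp add: a_def)
  have "(\<integral>\<^sup>+\<psi>\<in>{-pi..pi}. ennreal (r' / (\<rho>\<^sup>2 + 2 * r * r' * (1 - cos \<psi>))) \<partial>lborel)
      \<le> (\<integral>\<^sup>+\<psi>. ennreal (3 * a / (\<rho>\<^sup>2 + a\<^sup>2 * \<psi>\<^sup>2)) * indicator {-pi..pi} \<psi> \<partial>lborel)"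
  proof (intro nn_integral_mono)
    fix \<psi> :: real
    have "r' / (\<rho>\<^sup>2 + 2 * r * r' * (1 - cos \<psi>)) \<le> 3 * a / (\<rho>\<^sup>2 + a\<^sup>2 * \<psi>\<^sup>2)" if "\<bar>\<psi>\<bar> \<le> pi"
    proof -
      have "a\<^sup>2 * \<psi>\<^sup>2 \<le> r'\<^sup>2 * (\<psi>\<^sup>2 / 8)" by (simp add: a_def power_divide)
      also have "\<dots> \<le> r'\<^sup>2 * (1 - cos \<psi>)" by (intro mult_left_mono one_minus_cos_ge that) auto
      also have "\<dots> \<le> 2 * r * r' * (1 - cos \<psi>)"
        using True r by (intro mult_right_mono) (auto simp: power2_eq_square)
      finally have "a\<^sup>2 * \<psi>\<^sup>2 \<le> 2 * r * r' * (1 - cos \<psi>)" .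
      moreover have "0 < \<rho>\<^sup>2 + a\<^sup>2 * \<psi>\<^sup>2" using \<rho> by (intro add_pos_nonneg) auto
      ultimately show ?thesis using r by (intro frac_le) (auto simp: a_def)
    qed
    then show "ennreal (r' / (\<rho>\<^sup>2 + 2 * r * r' * (1 - cos \<psi>))) * indicator {-pi..pi} \<psi>
        \<le> ennreal (3 * a / (\<rho>\<^sup>2 + a\<^sup>2 * \<psi>\<^sup>2)) * indicator {-pi..pi} \<psi>"
      by (auto simp: indicator_def abs_le_iff intro: ennreal_leI)
  qed
  also have "\<dots> = ennreal (3 / \<rho> * arctan (a / \<rho> * pi) - 3 / \<rho> * arctan (a / \<rho> * (- pi)))"
  proof (rule nn_integral_FTC_Icc)
    fix \<psi> :: real
    have "0 < \<rho>\<^sup>2 + a\<^sup>2 * \<psi>\<^sup>2" using \<rho> by (intro add_pos_nonneg) auto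
    moreover have "1 + (a / \<rho> * \<psi>)\<^sup>2 = (\<rho>\<^sup>2 + a\<^sup>2 * \<psi>\<^sup>2) / \<rho>\<^sup>2"
      using \<rho> by (simp add: power_divide power_mult_distrib add_divide_distrib)
    ultimately show "((\<lambda>\<psi>. 3 / \<rho> * arctan (a / \<rho> * \<psi>)) has_real_derivative 3 * a / (\<rho>\<^sup>2 + a\<^sup>2 * \<psi>\<^sup>2)) (at \<psi>)"
      using \<rho> by (auto intro!: derivative_eq_intros simp: power2_eq_square divide_simps)
    show "0 \<le> 3 * a / (\<rho>\<^sup>2 + a\<^sup>2 * \<psi>\<^sup>2)" using a by simp
  qed (use pi_gt_zero in auto)
  also have "\<dots> \<le> ennreal (4 * pi / \<rho>)"
  proof (rule ennreal_leI)
    have "arctan (a / \<rho> * pi) - arctan (a / \<rho> * (- pi)) \<le> pi"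
      using arctan_bounded[of "a / \<rho> * pi"] arctan_bounded[of "a / \<rho> * (- pi)"] by linarith
    then have "3 / \<rho> * (arctan (a / \<rho> * pi) - arctan (a / \<rho> * (- pi))) \<le> 3 / \<rho> * pi"
      using \<rho> by (intro mult_left_mono) auto
    also have "\<dots> \<le> 4 * pi / \<rho>" using \<rho> by (simp add: divide_right_mono)
    finally show "3 / \<rho> * arctan (a / \<rho> * pi) - 3 / \<rho> * arctan (a / \<rho> * (- pi)) \<le> 4 * pi / \<rho>"
      by (simp add: right_diff_distrib)
  qed
  finally show ?thesis .
next
  case False
  then have "r' \<le> 2 * \<rho>" using r \<rho> by auto
  have "(\<integral>\<^sup>+\<psi>\<in>{-pi..pi}. ennreal (r' / (\<rho>\<^sup>2 + 2 * r * r' * (1 - cos \<psi>))) \<partial>lborel)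
      \<le> (\<integral>\<^sup>+\<psi>\<in>{-pi..pi}. ennreal (2 / \<rho>) \<partial>lborel)"
  proof (intro nn_integral_mono mult_right_mono ennreal_leI)
    fix \<psi> :: real
    have "r' / (\<rho>\<^sup>2 + 2 * r * r' * (1 - cos \<psi>)) \<le> (2 * \<rho>) / \<rho>\<^sup>2"
      using \<open>r' \<le> 2 * \<rho>\<close> r \<rho> by (intro frac_le) auto
    also have "\<dots> = 2 / \<rho>" using \<rho> by (simp add: power2_eq_square)
    finally show "r' / (\<rho>\<^sup>2 + 2 * r * r' * (1 - cos \<psi>)) \<le> 2 / \<rho>" .
  qed auto
  also have "\<dots> = ennreal (4 * pi / \<rho>)"
    using \<rho> by (simp add: nn_integral_cmult_indicator ennreal_mult[symmetric])
  finally show ?thesis .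
qed

text \<open>
  Periodicity gives this without the factor \<open>2\<close>; the cheaper bound covers the shifted period by two
  adjacent ones.
\<close>
lemma nn_integral_cos_shift_le:
  fixes g :: "real \<Rightarrow> ennreal"
  assumes [measurable]: "g \<in> borel_measurable borel"
  shows "(\<integral>\<^sup>+\<phi>\<in>{-pi..pi}. g (cos (\<phi> + \<beta>)) \<partial>lborel) \<le> 2 * (\<integral>\<^sup>+\<psi>\<in>{-pi..pi}. g (cos \<psi>) \<partial>lborel)"
proof -
  define n where "n = \<lfloor>\<beta> / (2 * pi)\<rfloor>"
  define b where "b = \<beta> - 2 * pi * of_int n"
  have "of_int n \<le> \<beta> / (2 * pi)" "\<beta> / (2 * pi) < of_int n + 1" unfolding n_def by linarith+
  then have b: "0 \<le> b" "b \<le> 2 * pi"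
    by (simp_all add: b_def field_simps)
  have cos: "cos (\<phi> + \<beta>) = cos (b + \<phi>)" for \<phi>
  proof -
    have "\<phi> + \<beta> = (b + \<phi>) + 2 * pi * of_int n" by (simp add: b_def)
    moreover have "cos (s + 2 * pi * of_int n) = cos s" for s
      by (simp add: cos_add cos_int_2pin sin_int_2pin)
    ultimately show ?thesis by metis
  qed
  have "(\<integral>\<^sup>+\<phi>\<in>{-pi..pi}. g (cos (\<phi> + \<beta>)) \<partial>lborel)
      = (\<integral>\<^sup>+\<phi>. g (cos (b + 1 * \<phi>)) * indicator {b - pi..b + pi} (b + 1 * \<phi>) \<partial>lborel)"
    unfolding cos by (intro nn_integral_cong) (auto simp: indicator_def)
  also have "\<dots> = (\<integral>\<^sup>+\<psi>\<in>{b - pi..b + pi}. g (cos \<psi>) \<partial>lborel)"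
    by (subst nn_integral_real_affine[where c = 1 and t = b]) auto
  also have "\<dots> \<le> (\<integral>\<^sup>+\<psi>. g (cos \<psi>) * indicator {-pi..pi} \<psi> + g (cos \<psi>) * indicator {pi..3 * pi} \<psi> \<partial>lborel)"
    using b by (intro nn_integral_mono) (auto simp: indicator_def)
  also have "\<dots> = (\<integral>\<^sup>+\<psi>\<in>{-pi..pi}. g (cos \<psi>) \<partial>lborel) + (\<integral>\<^sup>+\<psi>\<in>{pi..3 * pi}. g (cos \<psi>) \<partial>lborel)"
    by (intro nn_integral_add) measurable
  also have "(\<integral>\<^sup>+\<psi>\<in>{pi..3 * pi}. g (cos \<psi>) \<partial>lborel)
      = (\<integral>\<^sup>+\<psi>. g (cos (2 * pi + 1 * \<psi>)) * indicator {pi..3 * pi} (2 * pi + 1 * \<psi>) \<partial>lborel)"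
    by (subst nn_integral_real_affine[where c = 1 and t = "2 * pi"]) auto
  also have "\<dots> = (\<integral>\<^sup>+\<psi>\<in>{-pi..pi}. g (cos \<psi>) \<partial>lborel)"
    by (intro nn_integral_cong) (auto simp: indicator_def cos_add)
  finally show ?thesis by (simp add: mult_2)
qed

lemma continuous_on_axis_rotation: "continuous_on S (\<lambda>p. axis_rotation (fst p) (snd p))"
proof -
  have "continuous_on S (\<lambda>p. axis_rotation (fst p) (snd p) $ k)" for k
    using exhaust_3[of k] by (elim disjE; simp add: axis_rotation_def; intro continuous_intros)
  then have "continuous_on S (\<lambda>p. \<chi> k. axis_rotation (fst p) (snd p) $ k)" by (rule continuous_on_vec_lambda)
  then show ?thesis by simp
qed

lemma borel_measurable_cyl_radius [measurable]: "cyl_radius \<in> borel_measurable borel"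
  by (intro borel_measurable_continuous_onI continuous_intros)

lemma borel_measurable_meridional_dist [measurable]: "meridional_dist x \<in> borel_measurable borel"
  by (intro borel_measurable_continuous_onI continuous_intros)

lemma radius_diff_le_meridional_dist: "\<bar>cyl_radius x - cyl_radius y\<bar> \<le> meridional_dist x y"
  unfolding meridional_dist_def using real_sqrt_sum_squares_ge1 by (simp add: real_le_rsqrt)

lemma norm_axis_rotation_diff:
  obtains \<beta> where "\<And>\<phi>. (norm (axis_rotation \<phi> y - x))\<^sup>2
    = (meridional_dist x y)\<^sup>2 + 2 * cyl_radius x * cyl_radius y * (1 - cos (\<phi> + \<beta>))"
proof -
  obtain \<theta> where x: "x = cyl_point (cyl_radius x) \<theta> (x $ 3)" by (rule obtain_cyl_point)
  obtain \<alpha> where y: "y = cyl_point (cyl_radius y) \<alpha> (y $ 3)" by (rule obtain_cyl_point)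
  have "(norm (axis_rotation \<phi> y - x))\<^sup>2
    = (meridional_dist x y)\<^sup>2 + 2 * cyl_radius x * cyl_radius y * (1 - cos (\<phi> + (\<alpha> - \<theta>)))" for \<phi>
  proof -
    have "axis_rotation \<phi> y - x = cyl_point (cyl_radius y) (\<phi> + \<alpha>) (y $ 3) - cyl_point (cyl_radius x) \<theta> (x $ 3)"
      using x y axis_rotation_cyl_point by metis
    then show ?thesis
      by (simp only: norm_cyl_point_diff) (simp add: meridional_dist_def add_diff_eq)
  qed
  then show ?thesis by (rule that)
qed

lemma axis_rotation_0 [simp]: "axis_rotation 0 y = y"
  by (simp add: axis_rotation_def vec_eq_iff forall_3)

lemma meridional_dist_le_norm: "meridional_dist x y \<le> norm (y - x)"
proof -
  obtain \<beta> where \<beta>: "\<And>\<phi>. (norm (axis_rotation \<phi> y - x))\<^sup>2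
    = (meridional_dist x y)\<^sup>2 + 2 * cyl_radius x * cyl_radius y * (1 - cos (\<phi> + \<beta>))"
    by (rule norm_axis_rotation_diff) blast
  have "(meridional_dist x y)\<^sup>2 \<le> (norm (y - x))\<^sup>2"
    using \<beta>[of 0] by simp
  then show ?thesis by (rule power2_le_imp_le) simp
qed

text \<open>
  Rotating \<open>y\<close> changes neither Lebesgue measure nor \<open>F\<close> nor \<open>cyl_radius y\<close>, so the left-hand side equals
  its average over all rotations.  After exchanging the integrals the average falls on the kernel alone,
  where \<open>angular_integral_bound\<close> trades one power of the singularity for the weight \<open>cyl_radius y\<close>.
  On the null set where the meridional distance is zero the right-hand kernel is \<open>\<infinity>\<close>.
\<close>
lemma nn_integral_axisymmetric_le:
  fixes F :: "real^3 \<Rightarrow> ennreal"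
  assumes [measurable]: "F \<in> borel_measurable borel" and rot: "\<And>\<phi> y. F (axis_rotation \<phi> y) = F y"
  shows "(\<integral>\<^sup>+y. F y * ennreal (cyl_radius y / (norm (y - x))\<^sup>2) \<partial>lborel)
    \<le> 4 * (\<integral>\<^sup>+y. F y * inverse (ennreal (meridional_dist x y)) \<partial>lborel)"
proof -
  define K where "K = (\<lambda>y. F y * ennreal (cyl_radius y / (norm (y - x))\<^sup>2))"
  have [measurable]: "K \<in> borel_measurable borel" unfolding K_def by measurable
  have meas_rot [measurable]: "(\<lambda>p. axis_rotation (fst p) (snd p)) \<in> borel_measurable (lborel \<Otimes>\<^sub>M lborel)"
    unfolding lborel_prod by (simp add: borel_measurable_continuous_onI continuous_on_axis_rotation)
  have inner: "(\<integral>\<^sup>+\<phi>\<in>{-pi..pi}. ennreal (cyl_radius y / (norm (axis_rotation \<phi> y - x))\<^sup>2) \<partial>lborel)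
      \<le> ennreal (8 * pi) * inverse (ennreal (meridional_dist x y))" for y
  proof (cases "meridional_dist x y = 0")
    case True
    then show ?thesis by (simp add: ennreal_mult_top)
  next
    case False
    then have \<rho>: "0 < meridional_dist x y" by (simp add: less_le)
    obtain \<beta> where \<beta>: "\<And>\<phi>. (norm (axis_rotation \<phi> y - x))\<^sup>2
      = (meridional_dist x y)\<^sup>2 + 2 * cyl_radius x * cyl_radius y * (1 - cos (\<phi> + \<beta>))"
      by (rule norm_axis_rotation_diff) blast
    define g where "g = (\<lambda>c. ennreal (cyl_radius y / ((meridional_dist x y)\<^sup>2 + 2 * cyl_radius x * cyl_radius y * (1 - c))))"
    have [measurable]: "g \<in> borel_measurable borel" unfolding g_def by measurable
    have "(\<integral>\<^sup>+\<phi>\<in>{-pi..pi}. ennreal (cyl_radius y / (norm (axis_rotation \<phi> y - x))\<^sup>2) \<partial>lborel)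
        = (\<integral>\<^sup>+\<phi>\<in>{-pi..pi}. g (cos (\<phi> + \<beta>)) \<partial>lborel)"
      unfolding \<beta> g_def ..
    also have "\<dots> \<le> 2 * (\<integral>\<^sup>+\<psi>\<in>{-pi..pi}. g (cos \<psi>) \<partial>lborel)"
      by (rule nn_integral_cos_shift_le) measurable
    also have "\<dots> \<le> 2 * ennreal (4 * pi / meridional_dist x y)"
      unfolding g_def using \<rho> radius_diff_le_meridional_dist
      by (intro mult_left_mono angular_integral_bound) auto
    also have "\<dots> = ennreal (8 * pi) * inverse (ennreal (meridional_dist x y))"
      using \<rho> by (simp add: inverse_ennreal ennreal_mult'[symmetric] ennreal_numeral[symmetric] divide_inverse del: ennreal_numeral)
    finally show ?thesis .
  qed
  have "ennreal (2 * pi) * (\<integral>\<^sup>+y. K y \<partial>lborel) = (\<integral>\<^sup>+\<phi>\<in>{-pi..pi}. (\<integral>\<^sup>+y. K y \<partial>lborel) \<partial>lborel)"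
    by (simp add: nn_integral_cmult_indicator mult.commute)
  also have "\<dots> = (\<integral>\<^sup>+\<phi>\<in>{-pi..pi}. (\<integral>\<^sup>+y. K (axis_rotation \<phi> y) \<partial>lborel) \<partial>lborel)"
  proof (rule nn_integral_cong, rule arg_cong2[where f = "(*)", OF _ refl])
    fix \<phi>
    have [measurable]: "axis_rotation \<phi> \<in> borel_measurable borel"
      using measurable_compose[OF measurable_Pair1' meas_rot, of \<phi>] by simp
    have "(\<integral>\<^sup>+y. K y \<partial>lborel) = (\<integral>\<^sup>+y. K y \<partial>distr lborel borel (axis_rotation \<phi>))"
      by (simp add: distr_lborel_orthogonal orthogonal_axis_rotation)
    also have "\<dots> = (\<integral>\<^sup>+y. K (axis_rotation \<phi> y) \<partial>lborel)" by (intro nn_integral_distr) auto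
    finally show "(\<integral>\<^sup>+y. K y \<partial>lborel) = (\<integral>\<^sup>+y. K (axis_rotation \<phi> y) \<partial>lborel)" .
  qed
  also have "\<dots> = (\<integral>\<^sup>+\<phi>. \<integral>\<^sup>+y. K (axis_rotation \<phi> y) * indicator {-pi..pi} \<phi> \<partial>lborel \<partial>lborel)"
  proof (rule nn_integral_cong, rule nn_integral_multc[symmetric])
    fix \<phi>
    have [measurable]: "axis_rotation \<phi> \<in> borel_measurable borel"
      using measurable_compose[OF measurable_Pair1' meas_rot, of \<phi>] by simp
    show "(\<lambda>y. K (axis_rotation \<phi> y)) \<in> borel_measurable lborel" by measurable
  qed
  also have "\<dots> = (\<integral>\<^sup>+y. \<integral>\<^sup>+\<phi>. K (axis_rotation \<phi> y) * indicator {-pi..pi} \<phi> \<partial>lborel \<partial>lborel)"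
  proof (rule lborel_pair.Fubini'[symmetric])
    have [measurable]: "(\<lambda>p. K (axis_rotation (fst p) (snd p))) \<in> borel_measurable (lborel \<Otimes>\<^sub>M lborel)"
      using measurable_compose[OF meas_rot, of K] by simp
    show "(\<lambda>(\<phi>, y). K (axis_rotation \<phi> y) * indicator {-pi..pi} \<phi>) \<in> borel_measurable (lborel \<Otimes>\<^sub>M lborel)"
      unfolding case_prod_unfold by measurable
  qed
  also have "\<dots> \<le> (\<integral>\<^sup>+y. ennreal (8 * pi) * (F y * inverse (ennreal (meridional_dist x y))) \<partial>lborel)"
  proof (intro nn_integral_mono)
    fix y
    have [measurable]: "(\<lambda>\<phi>. axis_rotation \<phi> y) \<in> borel_measurable borel"
      using measurable_compose[OF measurable_Pair2' meas_rot, of y] by simp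
    have "(\<integral>\<^sup>+\<phi>. K (axis_rotation \<phi> y) * indicator {-pi..pi} \<phi> \<partial>lborel)
        = F y * (\<integral>\<^sup>+\<phi>\<in>{-pi..pi}. ennreal (cyl_radius y / (norm (axis_rotation \<phi> y - x))\<^sup>2) \<partial>lborel)"
      unfolding K_def rot cyl_radius_axis_rotation
      by (subst nn_integral_cmult[symmetric]) (auto simp: mult.assoc)
    also have "\<dots> \<le> F y * (ennreal (8 * pi) * inverse (ennreal (meridional_dist x y)))"
      by (intro mult_left_mono inner) auto
    finally show "(\<integral>\<^sup>+\<phi>. K (axis_rotation \<phi> y) * indicator {-pi..pi} \<phi> \<partial>lborel)
      \<le> ennreal (8 * pi) * (F y * inverse (ennreal (meridional_dist x y)))"
      by (simp add: mult_ac)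
  qed
  also have "\<dots> = ennreal (8 * pi) * (\<integral>\<^sup>+y. F y * inverse (ennreal (meridional_dist x y)) \<partial>lborel)"
    by (intro nn_integral_cmult) measurable
  also have "ennreal (8 * pi) = ennreal (2 * pi) * 4"
    by (simp add: ennreal_mult'[symmetric] ennreal_numeral[symmetric] del: ennreal_numeral)
  finally have "ennreal (2 * pi) * (\<integral>\<^sup>+y. K y \<partial>lborel)
      \<le> ennreal (2 * pi) * (4 * (\<integral>\<^sup>+y. F y * inverse (ennreal (meridional_dist x y)) \<partial>lborel))"
    by (simp only: mult.assoc)
  then show ?thesis
    unfolding K_def by (subst (asm) ennreal_mult_le_mult_iff) auto
qed

section \<open>Volume of meridional balls\<close>

text \<open>
  A meridional ball lies in a shell between two coaxial cylinders of height \<open>2 \<delta>\<close>, whose radii \<open>a \<le> b\<close>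
  are at most \<open>R\<close> and differ by at most \<open>2 \<delta>\<close>.  Scaling the two horizontal directions shows that the volume of
  the shell is \<open>(b\<^sup>2 - a\<^sup>2)\<close> times that of the cylinder of radius \<open>1\<close>, for which an enclosing box gives a
  sufficient bound.
\<close>
lemma emeasure_meridional_ball_le:
  assumes R: "0 < R" and \<delta>: "0 < \<delta>"
  shows "emeasure lborel {y. cyl_radius y < R \<and> meridional_dist x y < \<delta>} \<le> ennreal (32 * R * \<delta>\<^sup>2)"
proof -
  define C where "C = (\<lambda>b. {y::real^3. cyl_radius y < b \<and> \<bar>y$3 - x$3\<bar> < \<delta>})"
  have openC: "open (C b)" for b
    unfolding C_def by (intro open_Collect_conj open_Collect_less continuous_intros)
  have subbox: "C b \<subseteq> cbox (vector [-b, -b, x$3 - \<delta>]) (vector [b, b, x$3 + \<delta>])" for b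
  proof
    fix y assume y: "y \<in> C b"
    have "\<bar>y$1\<bar> \<le> cyl_radius y" "\<bar>y$2\<bar> \<le> cyl_radius y"
      unfolding cyl_radius_def by (auto simp: real_le_rsqrt)
    then show "y \<in> cbox (vector [-b, -b, x$3 - \<delta>]) (vector [b, b, x$3 + \<delta>])"
      using y by (auto simp: C_def mem_box_cart forall_3)
  qed
  have lmC [measurable]: "C b \<in> lmeasurable" for b
    by (rule lmeasurable_open[OF _ openC]) (rule bounded_subset[OF bounded_cbox subbox])
  have C1: "measure lebesgue (C 1) \<le> 8 * \<delta>"
  proof -
    define l m :: "real^3" where "l = vector [-1, -1, x$3 - \<delta>]" and "m = vector [1, 1, x$3 + \<delta>]"
    have ne: "\<forall>i. l $ i \<le> m $ i" using \<delta> by (simp add: l_def m_def forall_3)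
    have "measure lebesgue (C 1) \<le> measure lebesgue (cbox l m)"
      using subbox[of 1] fmeasurableD[OF lmC] unfolding l_def m_def
      by (intro measure_mono_fmeasurable lmeasurable_cbox)
    also have "\<dots> = measure lborel (cbox l m)" by simp
    also have "\<dots> = (\<Prod>i\<in>UNIV. m $ i - l $ i)"
      by (rule content_cbox_cart) (unfold interval_ne_empty_cart, rule ne)
    also have "\<dots> = 8 * \<delta>" unfolding UNIV_3 by (simp add: l_def m_def)
    finally show ?thesis .
  qed
  have scale: "measure lebesgue (C b) = b\<^sup>2 * measure lebesgue (C 1)" if "0 \<le> b" for b
  proof (cases "b = 0")
    case True
    have "C b = {}" using True by (auto simp: C_def not_less)
    then show ?thesis using True by simp
  next
    case False
    with that have b: "0 < b" by simp
    define f where "f = (\<lambda>y::real^3. vector [b * y$1, b * y$2, y$3] :: real^3)"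
    have lin: "linear f"
      by (rule linearI) (auto simp: f_def vec_eq_iff forall_3 algebra_simps)
    have rad: "cyl_radius (f y) = b * cyl_radius y" for y
    proof -
      have "(b * y$1)\<^sup>2 + (b * y$2)\<^sup>2 = b\<^sup>2 * ((y$1)\<^sup>2 + (y$2)\<^sup>2)" by (simp add: power_mult_distrib algebra_simps)
      then show ?thesis using b by (simp add: cyl_radius_def f_def real_sqrt_mult)
    qed
    have "f ` C 1 = C b"
    proof (intro equalityI subsetI)
      fix y assume "y \<in> f ` C 1"
      then show "y \<in> C b" using b by (auto simp: C_def rad) (auto simp: f_def)
    next
      fix y assume y: "y \<in> C b"
      define v where "v = (vector [y$1 / b, y$2 / b, y$3] :: real^3)"
      have fv: "f v = y" using b by (simp add: f_def v_def vec_eq_iff forall_3)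
      have "b * cyl_radius v < b * 1" using y rad[of v] fv by (simp add: C_def)
      then have "v \<in> C 1" using b y by (simp add: C_def v_def)
      then show "y \<in> f ` C 1" using fv by blast
    qed
    moreover have "det (matrix f) = b\<^sup>2"
      by (simp add: det_3 matrix_def f_def axis_def power2_eq_square)
    ultimately show ?thesis using measure_linear_image[OF lin lmC[of 1]] by simp
  qed
  define a where "a = max 0 (cyl_radius x - \<delta>)"
  define b where "b = min R (cyl_radius x + \<delta>)"
  have sub: "{y. cyl_radius y < R \<and> meridional_dist x y < \<delta>} \<subseteq> C b - C a"
  proof
    fix y assume y: "y \<in> {y. cyl_radius y < R \<and> meridional_dist x y < \<delta>}"
    have "\<bar>x$3 - y$3\<bar> \<le> meridional_dist x y"
      unfolding meridional_dist_def by (simp add: real_le_rsqrt)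
    then have 1: "\<bar>y$3 - x$3\<bar> < \<delta>" using y by (simp add: abs_minus_commute)
    have y': "cyl_radius y < R" "\<bar>cyl_radius x - cyl_radius y\<bar> < \<delta>"
      using y radius_diff_le_meridional_dist[of x y] by auto
    then have "cyl_radius y < b" unfolding b_def by linarith
    moreover have "\<not> cyl_radius y < a"
      using y' cyl_radius_nonneg[of y] unfolding a_def by linarith
    ultimately show "y \<in> C b - C a" using 1 by (simp add: C_def)
  qed
  show ?thesis
  proof (cases "a \<le> b")
    case True
    have a0: "0 \<le> a" by (simp add: a_def)
    have "emeasure lborel {y. cyl_radius y < R \<and> meridional_dist x y < \<delta>} \<le> emeasure lborel (C b - C a)"
      using openC by (intro emeasure_mono sub) auto
    also have "\<dots> = emeasure lebesgue (C b - C a)"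
      using openC by simp
    also have "\<dots> = ennreal (measure lebesgue (C b - C a))"
      by (intro emeasure_eq_measure2 fmeasurable_Diff lmC fmeasurableD)
    also have "measure lebesgue (C b - C a) = measure lebesgue (C b) - measure lebesgue (C a)"
      using True lmC by (intro measurable_measure_Diff) (auto simp: C_def intro: fmeasurableD)
    also have "\<dots> = (b\<^sup>2 - a\<^sup>2) * measure lebesgue (C 1)"
      using True a0 scale[of a] scale[of b] by (simp add: left_diff_distrib)
    also have "\<dots> \<le> (2 * \<delta> * (2 * R)) * (8 * \<delta>)"
    proof (intro mult_mono C1)
      have "b - a \<le> 2 * \<delta>" "b \<le> R" "a \<le> R" using True by (auto simp: a_def b_def)
      then have "(b - a) * (b + a) \<le> (2 * \<delta>) * (2 * R)" using True a0 \<delta> by (intro mult_mono) auto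
      then show "b\<^sup>2 - a\<^sup>2 \<le> 2 * \<delta> * (2 * R)" by (simp add: power2_eq_square algebra_simps)
    qed (use R \<delta> in auto)
    also have "\<dots> = 32 * R * \<delta>\<^sup>2" by (simp add: power2_eq_square)
    finally show ?thesis by (simp add: ennreal_leI)
  next
    case False
    then have "C b \<subseteq> C a" by (auto simp: C_def)
    with sub have "{y. cyl_radius y < R \<and> meridional_dist x y < \<delta>} = {}" by blast
    then show ?thesis by (simp only: emeasure_empty zero_le)
  qed
qed

lemma emeasure_meridional_kernel_le:
  assumes R: "0 < R" and t: "0 < t"
  shows "emeasure lborel {y. ennreal t < inverse (ennreal (meridional_dist x y))
      * indicator {y. cyl_radius y < R} x * indicator {y. cyl_radius y < R} y} \<le> ennreal (32 * R / t\<^sup>2)"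
proof -
  have "{y. ennreal t < inverse (ennreal (meridional_dist x y))
      * indicator {y. cyl_radius y < R} x * indicator {y. cyl_radius y < R} y}
    \<subseteq> {y. cyl_radius y < R \<and> meridional_dist x y < 1 / t}"
  proof safe
    fix y assume y: "ennreal t < inverse (ennreal (meridional_dist x y))
      * indicator {y. cyl_radius y < R} x * indicator {y. cyl_radius y < R} y"
    then show "cyl_radius y < R" by (cases "cyl_radius y < R") auto
    from y have "ennreal t < inverse (ennreal (meridional_dist x y))"
      by (cases "cyl_radius x < R"; cases "cyl_radius y < R") auto
    then show "meridional_dist x y < 1 / t"
      using t by (cases "meridional_dist x y = 0")
        (auto simp: inverse_ennreal less_le ennreal_less_iff field_simps)
  qed
  then have "emeasure lborel {y. ennreal t < inverse (ennreal (meridional_dist x y))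
      * indicator {y. cyl_radius y < R} x * indicator {y. cyl_radius y < R} y}
    \<le> emeasure lborel {y. cyl_radius y < R \<and> meridional_dist x y < 1 / t}"
    by (intro emeasure_mono) auto
  also have "\<dots> \<le> ennreal (32 * R * (1 / t)\<^sup>2)"
    using R t by (intro emeasure_meridional_ball_le) auto
  finally show ?thesis by (simp add: power_divide)
qed

section \<open>Velocity fields without swirl\<close>

text \<open>
  On the axis the representation by \<open>e_\<theta> \<theta>\<close> holds for every \<open>\<theta>\<close> with the same value of \<open>w\<close>, which
  forces the vorticity to vanish there.  Hence \<open>norm (curl u y)\<close> is \<open>cyl_radius y\<close> times the relative
  vorticity at every point, in spite of the division by zero.
\<close>
lemma norm_curl_no_swirl:
  assumes "axisymmetric_components (\<lambda>r z. 0) w (\<lambda>r z. 0) (curl u)"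
  shows "norm (curl u y) = \<bar>w (cyl_radius y) (y $ 3)\<bar>"
    and "cyl_radius y = 0 \<Longrightarrow> curl u y = 0"
proof -
  have curl: "curl u (cyl_point r \<theta> z) = w r z *\<^sub>R e_\<theta> \<theta>" if "0 \<le> r" for r \<theta> z
    using assms that by (simp add: axisymmetric_components_def)
  have ne: "norm (e_\<theta> \<theta>) = 1" for \<theta>
    by (simp add: e_\<theta>_def norm_vec_def L2_set_def sum_3)
  obtain \<theta> where y: "y = cyl_point (cyl_radius y) \<theta> (y $ 3)" by (rule obtain_cyl_point)
  show "norm (curl u y) = \<bar>w (cyl_radius y) (y $ 3)\<bar>"
    by (subst y, subst curl) (auto simp: ne)
  assume 0: "cyl_radius y = 0"
  have "w 0 z = 0" for z
  proof -
    have "cyl_point 0 0 z = cyl_point 0 pi z" by (simp add: cyl_point_def)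
    then have "w 0 z *\<^sub>R e_\<theta> 0 = w 0 z *\<^sub>R e_\<theta> pi" using curl by (metis order_refl)
    then have "(w 0 z *\<^sub>R e_\<theta> 0) $ 2 = (w 0 z *\<^sub>R e_\<theta> pi) $ 2"
      by (rule arg_cong[where f = "\<lambda>v. v $ 2"])
    then show ?thesis by (simp add: e_\<theta>_def)
  qed
  then show "curl u y = 0" using 0 by (subst y, subst curl) auto
qed

text \<open>
  The Biot-Savart potential is split at \<open>cyl_radius y = 2 R\<close>.  Inside, averaging over rotations replaces
  the kernel.  Outside, \<open>|x - y| \<ge> cyl_radius y / 2\<close>, so the kernel times \<open>cyl_radius y\<close> is at most
  \<open>2 / R\<close>.  The constants come from \<open>3\<close> components, each with the factor \<open>15 / 2\<close>, and the factor \<open>4\<close>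
  of the averaging.
\<close>
lemma norm_velocity_le:
  assumes smooth: "smooth u" and div: "\<And>y. divergence u y = 0"
    and axi: "axisymmetric_components (\<lambda>r z. 0) w (\<lambda>r z. 0) (curl u)"
    and vanish: "vanishes_at_infinity_in_mean u"
    and R: "0 < R" and x: "cyl_radius x < R"
  defines "f \<equiv> \<lambda>y. norm (curl u y) / cyl_radius y"
  shows "ennreal (norm (u x)) \<le> 90 * (\<integral>\<^sup>+y. ennreal (f y) * inverse (ennreal (meridional_dist x y))
      * indicator {y. cyl_radius y < 2 * R} y \<partial>lborel) + ennreal (45 / R) * (\<integral>\<^sup>+y. ennreal (f y) \<partial>lborel)"
proof -
  have [measurable]: "curl u \<in> borel_measurable borel"
    using continuous_on_curl[OF smooth] by (rule borel_measurable_continuous_onI)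
  have [measurable]: "f \<in> borel_measurable borel" unfolding f_def by measurable
  define D where "D = {y. cyl_radius y < 2 * R}"
  have [measurable]: "D \<in> sets borel" unfolding D_def by measurable
  define F where "F = (\<lambda>y. ennreal (f y) * indicator D y)"
  have [measurable]: "F \<in> borel_measurable borel" unfolding F_def by measurable
  have Frot: "F (axis_rotation \<phi> y) = F y" for \<phi> y
    by (simp add: F_def f_def D_def norm_curl_no_swirl(1)[OF axi] indicator_def)
  have point: "ennreal (norm (curl u y) / (norm (y - x))\<^sup>2)
      \<le> F y * ennreal (cyl_radius y / (norm (y - x))\<^sup>2) + ennreal (2 / R) * ennreal (f y)" for y
  proof (cases "cyl_radius y < 2 * R")
    case True
    have "norm (curl u y) = f y * cyl_radius y"
      using norm_curl_no_swirl(2)[OF axi, of y] by (auto simp: f_def)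
    then have "ennreal (norm (curl u y) / (norm (y - x))\<^sup>2) = F y * ennreal (cyl_radius y / (norm (y - x))\<^sup>2)"
      using True by (simp add: F_def D_def f_def ennreal_mult'[symmetric])
    then show ?thesis by simp
  next
    case False
    then have ry: "0 < cyl_radius y" using R by simp
    have "cyl_radius y - cyl_radius x \<le> norm (y - x)"
      using radius_diff_le_meridional_dist[of x y] meridional_dist_le_norm[of x y] by linarith
    then have "cyl_radius y / 2 \<le> norm (y - x)" using False x by linarith
    then have "(cyl_radius y / 2)\<^sup>2 \<le> (norm (y - x))\<^sup>2" using ry by (intro power_mono) auto
    then have "norm (curl u y) / (norm (y - x))\<^sup>2 \<le> norm (curl u y) / (cyl_radius y / 2)\<^sup>2"
      using ry by (intro divide_left_mono mult_pos_pos) (auto intro: less_le_trans[rotated])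
    also have "\<dots> = 4 / cyl_radius y * f y" using ry by (simp add: f_def power2_eq_square)
    also have "\<dots> \<le> 2 / R * f y"
      using False R ry by (intro mult_right_mono) (auto simp: f_def field_simps)
    finally show ?thesis
      using R by (simp add: ennreal_mult'[symmetric] ennreal_leI add_increasing)
  qed
  have "ennreal (norm (u x)) \<le> ennreal (\<Sum>i\<in>UNIV. \<bar>u x $ i\<bar>)"
    by (intro ennreal_leI norm_le_l1_cart)
  also have "\<dots> = (\<Sum>i\<in>UNIV. ennreal \<bar>u x $ i\<bar>)" by simp
  also have "\<dots> \<le> (\<Sum>i\<in>(UNIV::3 set). ennreal (15 / 2) * (\<integral>\<^sup>+y. ennreal (norm (curl u y) / (norm (y - x))\<^sup>2) \<partial>lborel))"
    by (intro sum_mono abs_component_le_vorticity_potential smooth div vanish)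
  also have "\<dots> = ennreal (45 / 2) * (\<integral>\<^sup>+y. ennreal (norm (curl u y) / (norm (y - x))\<^sup>2) \<partial>lborel)"
    by (simp add: mult.assoc[symmetric] ennreal_mult'[symmetric] ennreal_numeral[symmetric] del: ennreal_numeral)
  also have "\<dots> \<le> ennreal (45 / 2) * (\<integral>\<^sup>+y. F y * ennreal (cyl_radius y / (norm (y - x))\<^sup>2) + ennreal (2 / R) * ennreal (f y) \<partial>lborel)"
    by (intro mult_left_mono nn_integral_mono point) auto
  also have "\<dots> = ennreal (45 / 2) * ((\<integral>\<^sup>+y. F y * ennreal (cyl_radius y / (norm (y - x))\<^sup>2) \<partial>lborel)
      + ennreal (2 / R) * (\<integral>\<^sup>+y. ennreal (f y) \<partial>lborel))"
    by (simp add: nn_integral_add nn_integral_cmult)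
  also have "\<dots> \<le> ennreal (45 / 2) * (4 * (\<integral>\<^sup>+y. F y * inverse (ennreal (meridional_dist x y)) \<partial>lborel)
      + ennreal (2 / R) * (\<integral>\<^sup>+y. ennreal (f y) \<partial>lborel))"
    by (intro mult_left_mono add_right_mono nn_integral_axisymmetric_le Frot) auto
  also have "\<dots> = 90 * (\<integral>\<^sup>+y. F y * inverse (ennreal (meridional_dist x y)) \<partial>lborel)
      + ennreal (45 / R) * (\<integral>\<^sup>+y. ennreal (f y) \<partial>lborel)"
    using R by (simp add: distrib_left mult.assoc[symmetric] ennreal_mult'[symmetric] ennreal_numeral[symmetric] del: ennreal_numeral)
  finally show ?thesis by (simp add: F_def D_def mult_ac)
qed

lemma cylinder_subset_cbox: "cylinder R \<subseteq> cbox (vector [-R, -R, -R]) (vector [R, R, R])"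
  and cyl_radius_less_of_cylinder: "x \<in> cylinder R \<Longrightarrow> cyl_radius x < R"
  and sets_cylinder [measurable]: "cylinder R \<in> sets borel"
proof -
  have eq: "cylinder R = {x. cyl_radius x < R \<and> -R \<le> x $ 3 \<and> x $ 3 \<le> R}"
    by (auto simp: cylinder_def cyl_radius_def norm_vec_def L2_set_def sum_2)
  then show "x \<in> cylinder R \<Longrightarrow> cyl_radius x < R" by simp
  show "cylinder R \<in> sets borel" unfolding eq by measurable
  show "cylinder R \<subseteq> cbox (vector [-R, -R, -R]) (vector [R, R, R])"
  proof
    fix x assume "x \<in> cylinder R"
    then have "cyl_radius x < R" "-R \<le> x $ 3" "x $ 3 \<le> R" unfolding eq by auto
    moreover have "\<bar>x$1\<bar> \<le> cyl_radius x" "\<bar>x$2\<bar> \<le> cyl_radius x"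
      unfolding cyl_radius_def by (auto simp: real_le_rsqrt)
    ultimately show "x \<in> cbox (vector [-R, -R, -R]) (vector [R, R, R])"
      by (auto simp: mem_box_cart forall_3)
  qed
qed

text \<open>
  Here \<open>q\<close> and \<open>r\<close> are conjugate exponents.  Where \<open>|u|\<close> is at most \<open>b\<close>, twice the far contribution, the
  finite volume of the cylinder suffices.  On the remaining set \<open>E\<close> the near contribution dominates, and the
  bilinear inequality is tested with \<open>h = |u| powr (q - 1)\<close> on \<open>E\<close>: if \<open>X\<close> is the integral of
  \<open>|u| powr q\<close> over \<open>E\<close>, it yields \<open>X \<le> 180 c S X powr (1 / r)\<close>.  Since \<open>u\<close> is bounded on the
  cylinder, \<open>X\<close> is finite and can be cancelled, which leaves a bound of \<open>X powr (1 / q)\<close>.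
\<close>
lemma nn_integral_velocity_powr_le:
  fixes p R S :: real
  assumes p: "1 < p" "p < 2" and R: "0 < R" and S: "0 < S"
    and smooth: "smooth u" and div: "\<And>y. divergence u y = 0"
    and axi: "axisymmetric_components (\<lambda>r z. 0) w (\<lambda>r z. 0) (curl u)"
    and vanish: "vanishes_at_infinity_in_mean u"
  defines "q \<equiv> 2 * p / (2 - p)" and "f \<equiv> \<lambda>y. norm (curl u y) / cyl_radius y"
  defines "r \<equiv> 2 * p / (3 * p - 2)"
  assumes f1: "(\<integral>\<^sup>+y. ennreal (f y) \<partial>lborel) \<le> ennreal S"
    and fp: "(\<integral>\<^sup>+y. ennreal (f y powr p) \<partial>lborel) \<le> ennreal (S powr p)"
  shows "(\<integral>\<^sup>+x\<in>cylinder R. ennreal (norm (u x) powr q) \<partial>lborel)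
    \<le> ennreal (((90 / R) powr q * measure lborel (cylinder R)
        + (180 * (2 + 64 * R / (2 - r) + 64 * R / (2 - p))) powr q) * S powr q)"
proof -
  have contu: "continuous_on UNIV u" using smooth by (rule smooth_jacobian(1))
  have [measurable]: "u \<in> borel_measurable borel" "curl u \<in> borel_measurable borel"
    using contu continuous_on_curl[OF smooth] by (auto intro: borel_measurable_continuous_onI)
  have [measurable]: "f \<in> borel_measurable borel" unfolding f_def by measurable
  have f0: "0 \<le> f y" for y by (simp add: f_def)
  have q: "1 < q" using p by (simp add: q_def field_simps)
  have r: "1 \<le> r" "r < 2" and pr: "1 / r + 1 / p = 3 / 2" and qr2: "1 - 1 / r = 1 / q"
    using p by (simp_all add: r_def q_def field_simps)
  have "q - 1 = (3 * p - 2) / (2 - p)" using p by (simp add: q_def field_simps)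
  then have "(q - 1) * r = q" using p by (simp add: r_def q_def)
  note qr = this qr2
  define D where "D = {y. cyl_radius y < 2 * R}"
  have [measurable]: "D \<in> sets borel" unfolding D_def by measurable
  define k where "k = (\<lambda>x y. inverse (ennreal (meridional_dist x y)) * indicator D x * indicator D y)"
  define b where "b = 90 * S / R"
  define E where "E = {x \<in> cylinder R. b < norm (u x)}"
  have [measurable]: "E \<in> sets borel" unfolding E_def by measurable
  define h where "h = (\<lambda>x. norm (u x) powr (q - 1) * indicator E x)"
  have [measurable]: "h \<in> borel_measurable borel" unfolding h_def by measurable
  have h0: "0 \<le> h x" for x by (simp add: h_def)
  define c where "c = 2 + 64 * R / (2 - r) + 64 * R / (2 - p)"
  have c: "0 < c" using R p r by (simp add: c_def add_pos_nonneg)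
  have finV: "emeasure lborel (cylinder R) < \<infinity>"
  proof -
    have "emeasure lborel (cylinder R) \<le> emeasure lborel (cbox (vector [-R, -R, -R]) (vector [R, R, R] :: real^3))"
      by (intro emeasure_mono cylinder_subset_cbox) auto
    also have "\<dots> < \<infinity>" by (rule emeasure_lborel_cbox_finite)
    finally show ?thesis .
  qed
  obtain B where B: "\<And>x. x \<in> cylinder R \<Longrightarrow> norm (u x) \<le> B"
  proof -
    have "compact (u ` cbox (vector [-R, -R, -R]) (vector [R, R, R]))"
      by (intro compact_continuous_image continuous_on_subset[OF contu]) auto
    then obtain B where "\<forall>z\<in>u ` cbox (vector [-R, -R, -R]) (vector [R, R, R]). norm z \<le> B"
      using compact_imp_bounded bounded_iff by blast
    then show ?thesis using cylinder_subset_cbox[of R] by (intro that[of B]) blast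
  qed
  have large: "ennreal (norm (u x)) \<le> 180 * (\<integral>\<^sup>+y. ennreal (f y) * k x y \<partial>lborel)" if x: "x \<in> E" for x
  proof -
    have rx: "cyl_radius x < R" and bx: "b < norm (u x)"
      using x cyl_radius_less_of_cylinder by (auto simp: E_def)
    define T where "T = (\<integral>\<^sup>+y. ennreal (f y) * k x y \<partial>lborel)"
    have T: "(\<integral>\<^sup>+y. ennreal (f y) * inverse (ennreal (meridional_dist x y))
      * indicator {y. cyl_radius y < 2 * R} y \<partial>lborel) = T"
      unfolding T_def k_def D_def using rx R by (intro nn_integral_cong) (simp add: mult.assoc)
    have "ennreal (norm (u x)) \<le> 90 * T + ennreal (45 / R) * (\<integral>\<^sup>+y. ennreal (f y) \<partial>lborel)"
      using norm_velocity_le[OF smooth div axi vanish R rx] T unfolding f_def by simp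
    also have "\<dots> \<le> 90 * T + ennreal (45 / R) * ennreal S"
      by (intro add_left_mono mult_left_mono f1) auto
    also have "ennreal (45 / R) * ennreal S = ennreal (b / 2)"
      using R S by (simp add: ennreal_mult'[symmetric] b_def)
    finally have main: "ennreal (norm (u x)) \<le> 90 * T + ennreal (b / 2)" .
    show ?thesis
    proof (cases T)
      case (real t)
      have eq: "90 * T + ennreal (b / 2) = ennreal (90 * t + b / 2)"
        using real R S by (simp add: b_def ennreal_mult'[symmetric] ennreal_numeral[symmetric] ennreal_plus[symmetric] del: ennreal_numeral ennreal_plus)
      have "0 \<le> 90 * t + b / 2" using real R S by (simp add: b_def)
      then have "norm (u x) \<le> 90 * t + b / 2"
        using main[unfolded eq] by (rule ennreal_le_iff[THEN iffD1])
      then have "norm (u x) \<le> 180 * t" using bx by linarith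
      then have "ennreal (norm (u x)) \<le> ennreal (180 * t)" by (rule ennreal_leI)
      also have "\<dots> = 180 * T"
        using real by (simp add: ennreal_mult'[symmetric] ennreal_numeral[symmetric] del: ennreal_numeral)
      finally show ?thesis by (simp add: T_def)
    next
      case top
      then show ?thesis by (simp add: T_def ennreal_mult_top)
    qed
  qed
  define X where "X = (\<integral>\<^sup>+x\<in>E. ennreal (norm (u x) powr q) \<partial>lborel)"
  have Xfin: "X < \<infinity>"
  proof -
    have "X \<le> (\<integral>\<^sup>+x. ennreal (B powr q) * indicator (cylinder R) x \<partial>lborel)"
      unfolding X_def using B q
      by (intro nn_integral_mono) (auto simp: indicator_def E_def intro!: ennreal_leI powr_mono2)
    also have "\<dots> < \<infinity>" using finV by (simp add: nn_integral_cmult_indicator ennreal_mult_less_top)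
    finally show ?thesis .
  qed
  define X' where "X' = enn2real X"
  have X': "X = ennreal X'" "0 \<le> X'" using Xfin by (auto simp: X'_def)
  have hr: "(\<integral>\<^sup>+x. ennreal (h x powr r) \<partial>lborel) = ennreal X'"
    unfolding X'(1)[symmetric] X_def
    by (intro nn_integral_cong) (auto simp: h_def indicator_def powr_powr qr)
  have Xbound: "X' \<le> (180 * c * S) powr q"
  proof (cases "X' = 0")
    case False
    with X' have Xpos: "0 < X'" by simp
    have "ennreal X' \<le> (\<integral>\<^sup>+x. ennreal (h x) * (180 * (\<integral>\<^sup>+y. ennreal (f y) * k x y \<partial>lborel)) \<partial>lborel)"
      unfolding X'(1)[symmetric] X_def
    proof (intro nn_integral_mono)
      fix x
      show "ennreal (norm (u x) powr q) * indicator E x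
          \<le> ennreal (h x) * (180 * (\<integral>\<^sup>+y. ennreal (f y) * k x y \<partial>lborel))"
      proof (cases "x \<in> E")
        case True
        have "norm (u x) powr q = h x * norm (u x)"
          using True powr_add[of "norm (u x)" "q - 1" 1] by (simp add: h_def)
        then have "ennreal (norm (u x) powr q) * indicator E x = ennreal (h x) * ennreal (norm (u x))"
          using True h0 by (simp add: ennreal_mult)
        also have "\<dots> \<le> ennreal (h x) * (180 * (\<integral>\<^sup>+y. ennreal (f y) * k x y \<partial>lborel))"
          by (intro mult_left_mono large True) auto
        finally show ?thesis .
      qed simp
    qed
    also have "\<dots> = (\<integral>\<^sup>+x. 180 * (\<integral>\<^sup>+y. ennreal (h x * f y) * k x y \<partial>lborel) \<partial>lborel)"
    proof (intro nn_integral_cong)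
      fix x
      have [measurable]: "k x \<in> borel_measurable borel" unfolding k_def by measurable
      have "(\<integral>\<^sup>+y. ennreal (h x * f y) * k x y \<partial>lborel) = ennreal (h x) * (\<integral>\<^sup>+y. ennreal (f y) * k x y \<partial>lborel)"
        using h0 f0 by (subst nn_integral_cmult[symmetric]) (auto simp: ennreal_mult mult.assoc)
      then show "ennreal (h x) * (180 * (\<integral>\<^sup>+y. ennreal (f y) * k x y \<partial>lborel))
          = 180 * (\<integral>\<^sup>+y. ennreal (h x * f y) * k x y \<partial>lborel)"
        by (simp add: mult_ac)
    qed
    also have "\<dots> = 180 * (\<integral>\<^sup>+x. \<integral>\<^sup>+y. ennreal (h x * f y) * k x y \<partial>lborel \<partial>lborel)"
    proof (rule nn_integral_cmult)
      have [measurable]: "(\<lambda>z. meridional_dist (fst z) (snd z)) \<in> borel_measurable (lborel \<Otimes>\<^sub>M lborel)"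
        unfolding lborel_prod by (simp add: borel_measurable_continuous_onI continuous_intros)
      show "(\<lambda>x. \<integral>\<^sup>+y. ennreal (h x * f y) * k x y \<partial>lborel) \<in> borel_measurable lborel"
        unfolding k_def by measurable
    qed
    also have "\<dots> \<le> 180 * ennreal ((2 + 64 * R / (2 - r) + 64 * R / (2 - p)) * X' powr (1 / r) * S)"
    proof (intro mult_left_mono HLS_bilinear[where M = lborel and A = "64 * R"])
      have [measurable]: "(\<lambda>z. meridional_dist (fst z) (snd z)) \<in> borel_measurable (lborel \<Otimes>\<^sub>M lborel)"
        unfolding lborel_prod by (simp add: borel_measurable_continuous_onI continuous_intros)
      show "(\<lambda>z. k (fst z) (snd z)) \<in> borel_measurable (lborel \<Otimes>\<^sub>M lborel)"
        unfolding k_def by measurable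
      show "k x y = k y x" for x y by (simp add: k_def meridional_dist_commute mult_ac)
      show "emeasure lborel {y \<in> space lborel. ennreal t < k x y} \<le> ennreal (64 * R / t\<^sup>2)" if "0 < t" for x t
        using emeasure_meridional_kernel_le[of "2 * R" t x] R that by (simp add: k_def D_def)
      show "(\<integral>\<^sup>+y. ennreal (h y powr r) \<partial>lborel) \<le> ennreal ((X' powr (1 / r)) powr r)"
        unfolding hr using Xpos r by (simp add: powr_powr)
    qed (use p r pr R S Xpos f0 h0 fp lborel.sigma_finite_measure_axioms in auto)
    also have "\<dots> = ennreal (180 * c * S * X' powr (1 / r))"
      by (simp add: c_def ennreal_mult'[symmetric] ennreal_numeral[symmetric] mult_ac del: ennreal_numeral)
    finally have "X' \<le> 180 * c * S * X' powr (1 / r)"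
      using c S by (subst (asm) ennreal_le_iff) auto
    then have "X' / X' powr (1 / r) \<le> 180 * c * S" using Xpos by (simp add: field_simps)
    also have "X' / X' powr (1 / r) = X' powr (1 / q)"
      using Xpos powr_diff[of X' 1 "1 / r"] by (simp add: qr(2))
    finally have "(X' powr (1 / q)) powr q \<le> (180 * c * S) powr q"
      using q by (intro powr_mono2) auto
    then show ?thesis using q Xpos by (simp add: powr_powr)
  qed simp
  have "(\<integral>\<^sup>+x\<in>cylinder R. ennreal (norm (u x) powr q) \<partial>lborel)
      \<le> (\<integral>\<^sup>+x. ennreal (b powr q) * indicator (cylinder R) x + ennreal (norm (u x) powr q) * indicator E x \<partial>lborel)"
    using q by (intro nn_integral_mono)
      (auto simp: indicator_def E_def not_less intro!: ennreal_leI powr_mono2)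
  also have "\<dots> = ennreal (b powr q) * emeasure lborel (cylinder R) + X"
    unfolding X_def by (subst nn_integral_add) (auto simp: nn_integral_cmult_indicator)
  also have "\<dots> \<le> ennreal (b powr q * measure lborel (cylinder R)) + ennreal ((180 * c * S) powr q)"
    using finV Xbound unfolding X'(1)
    by (intro add_mono ennreal_leI) (auto simp: emeasure_eq_ennreal_measure less_top ennreal_mult')
  also have "\<dots> = ennreal (((90 / R) powr q * measure lborel (cylinder R) + (180 * c) powr q) * S powr q)"
    using R S c by (simp add: ennreal_plus[symmetric] b_def powr_mult powr_divide algebra_simps del: ennreal_plus)
  finally show ?thesis by (simp add: c_def)
qed

theorem proposition3p3:
  fixes p R :: real
  assumes "1 < p" and "p < 2" and "0 < R"
  shows "\<exists>C::real. 0 < C \<and>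
    (\<forall>(T::real set) (u::real \<Rightarrow> real^3 \<Rightarrow> real^3)
      (ur::real \<Rightarrow> real \<Rightarrow> real \<Rightarrow> real) (uz::real \<Rightarrow> real \<Rightarrow> real \<Rightarrow> real)
      (w::real \<Rightarrow> real \<Rightarrow> real \<Rightarrow> real).
      (\<forall>t\<in>T. smooth (u t)
         \<and> axisymmetric_components (\<lambda>r z. ur r z t) (\<lambda>r z. 0) (\<lambda>r z. uz r z t) (u t)
         \<and> (\<forall>x. divergence (u t) x = 0)
         \<and> axisymmetric_components (\<lambda>r z. 0) (\<lambda>r z. w r z t) (\<lambda>r z. 0) (curl (u t))
         \<and> vanishes_at_infinity_in_mean (u t))
      \<longrightarrow> (\<forall>t\<in>T. Lp_norm (2*p/(2-p)) (cylinder R) (u t)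
            \<le> ennreal C * (Lp_norm 1 UNIV (relative_vorticity (\<lambda>r z. w r z t))
                          + Lp_norm p UNIV (relative_vorticity (\<lambda>r z. w r z t)))))"
proof -
  define q where "q = 2 * p / (2 - p)"
  define r where "r = 2 * p / (3 * p - 2)"
  have q: "1 < q" using assms by (simp add: q_def field_simps)
  define K where "K = (90 / R) powr q * measure lborel (cylinder R)
        + (180 * (2 + 64 * R / (2 - r) + 64 * R / (2 - p))) powr q"
  have K: "0 < K"
  proof -
    have "r < 2" using assms by (simp add: r_def field_simps)
    then have "0 < 180 * (2 + 64 * R / (2 - r) + 64 * R / (2 - p))"
      using assms by (simp add: add_pos_nonneg)
    then show ?thesis unfolding K_def by (intro add_nonneg_pos) auto
  qed
  define C where "C = K powr (1 / q)"
  have C: "0 < C" using K by (simp add: C_def)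
  have main: "Lp_norm q (cylinder R) u
      \<le> ennreal C * (Lp_norm 1 UNIV (relative_vorticity w) + Lp_norm p UNIV (relative_vorticity w))"
    if u: "smooth u" "\<And>x. divergence u x = 0"
      "axisymmetric_components (\<lambda>r z. 0) w (\<lambda>r z. 0) (curl u)" "vanishes_at_infinity_in_mean u" for u w
  proof (cases "Lp_norm 1 UNIV (relative_vorticity w) + Lp_norm p UNIV (relative_vorticity w) = \<infinity>")
    case True
    show ?thesis unfolding True using C by (simp add: ennreal_mult_top)
  next
    case False
    define f where "f = (\<lambda>y. norm (curl u y) / cyl_radius y)"
    have f: "norm (relative_vorticity w y) = f y" for y
      by (simp add: relative_vorticity_def f_def norm_curl_no_swirl(1)[OF u(3)])
    have f0: "0 \<le> f y" for y by (simp add: f_def)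
    define N where "N = enn2real (Lp_norm 1 UNIV (relative_vorticity w) + Lp_norm p UNIV (relative_vorticity w))"
    have N: "Lp_norm 1 UNIV (relative_vorticity w) + Lp_norm p UNIV (relative_vorticity w) = ennreal N"
      using False by (simp add: N_def less_top)
    have norm_le: "(\<integral>\<^sup>+y. ennreal (f y powr s) \<partial>lborel) \<le> ennreal (S powr s)"
      if le: "Lp_norm s UNIV (relative_vorticity w) \<le> ennreal S" and s: "1 \<le> s" and S: "0 \<le> S" for s S
    proof -
      define I where "I = (\<integral>\<^sup>+y. ennreal (f y powr s) \<partial>lborel)"
      have L: "Lp_norm s UNIV (relative_vorticity w) = (if I = \<infinity> then \<infinity> else ennreal (enn2real I powr (1 / s)))"
        unfolding Lp_norm_def I_def f by simp
      with le have I: "I \<noteq> \<infinity>" by (auto simp: top_unique)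
      with L le have "enn2real I powr (1 / s) \<le> S" using S by (simp add: ennreal_le_iff)
      then have "(enn2real I powr (1 / s)) powr s \<le> S powr s" using s by (intro powr_mono2) auto
      then have "enn2real I \<le> S powr s" using s by (simp add: powr_powr)
      then show ?thesis using I unfolding I_def[symmetric]
        by (metis ennreal_enn2real ennreal_leI infinity_ennreal_def less_top)
    qed
    \<comment> \<open>A strict majorant of the norms is used so that it is positive even when the vorticity vanishes.\<close>
    have bound: "Lp_norm q (cylinder R) u \<le> ennreal (C * S)" if S: "N < S" for S
    proof -
      have S0: "0 < S" using S by (simp add: N_def less_le_trans[rotated] order_le_less_trans[OF enn2real_nonneg])
      have "Lp_norm 1 UNIV (relative_vorticity w) \<le> ennreal N" "Lp_norm p UNIV (relative_vorticity w) \<le> ennreal N"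
        unfolding N[symmetric] by simp_all
      then have le: "Lp_norm 1 UNIV (relative_vorticity w) \<le> ennreal S" "Lp_norm p UNIV (relative_vorticity w) \<le> ennreal S"
        using S by (meson ennreal_leI less_imp_le order_trans)+
      define I where "I = (\<integral>\<^sup>+x\<in>cylinder R. ennreal (norm (u x) powr q) \<partial>lborel)"
      have "(\<integral>\<^sup>+y. ennreal (f y) \<partial>lborel) \<le> ennreal S"
        using norm_le[OF le(1)] S0 f0 by simp
      moreover have "(\<integral>\<^sup>+y. ennreal (f y powr p) \<partial>lborel) \<le> ennreal (S powr p)"
        using norm_le[OF le(2)] S0 assms by simp
      ultimately have I: "I \<le> ennreal (K * S powr q)"
        using nn_integral_velocity_powr_le[OF assms S0 u] unfolding I_def K_def q_def r_def f_def by blast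
      then have "I \<noteq> \<infinity>" by (auto simp: top_unique)
      moreover have "enn2real I powr (1 / q) \<le> (K * S powr q) powr (1 / q)"
        using I K q by (intro powr_mono2) (auto simp: enn2real_leI)
      moreover have "(K * S powr q) powr (1 / q) = C * S"
        using K S0 q by (simp add: C_def powr_mult powr_powr)
      ultimately show ?thesis
        unfolding Lp_norm_def I_def[symmetric] by (simp add: ennreal_leI)
    qed
    show ?thesis unfolding N
    proof (rule ennreal_le_epsilon)
      fix e :: real assume e: "0 < e"
      have "Lp_norm q (cylinder R) u \<le> ennreal (C * (N + e / C))"
        using e C by (intro bound) simp
      also have "\<dots> = ennreal C * ennreal N + ennreal e"
        using e C by (simp add: N_def distrib_left ennreal_mult)
      finally show "Lp_norm q (cylinder R) u \<le> ennreal C * ennreal N + ennreal e" .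
    qed
  qed
  show ?thesis
    unfolding q_def[symmetric] using C main by (intro exI[of _ C]) blast
qed

end
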